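(* Let $X_1:\Omega_1\to\mathrm{DCS}(0,1)$ and $X_2:\Omega_2\to\mathrm{DCS}(0,1)$ be two random dense countable subsets of $(0,1)$ (defined on possibly different standard probability spaces). Suppose that each $X=X_i$ ($i=1,2$) satisfies the independence condition and, for all Borel sets $A\subset(0,1)$: $X\cap A=\emptyset$ almost surely if $\operatorname{mes}(A)=0$, and $X\cap A$ is infinite almost surely if $\operatorname{mes}(A)>0$. Then $X_1$ and $X_2$ are identically distributed.
   Context: All probability spaces are standard (Lebesgue–Rokhlin); $\operatorname{mes}$ is Lebesgue measure on $(0,1)$. $\mathrm{DCS}(0,1)$ is the set of all dense countable subsets of $(0,1)$, viewed as the quotient $B/E$, where $B=(0,1)^\infty_{\neq}$ is the standard Borel space of all sequences of pairwise different points of $(0,1)$ (only sequences whose set of values is dense matter), and $E$ identifies two sequences differing by a permutation of $\{1,2,\dots\}$. A random dense countable subset of $(0,1)$ is a map $X:\Omega\to\mathrm{DCS}(0,1)$ on a probability space $\Omega$ which is measurable in the sense that it admits a measurable lifting $Y=(Y_1,Y_2,\dots):\Omega\to B$ (a measurable enumeration): the $Y_k$ are random variables, pairwise different, and $X(\omega)=\{Y_1(\omega),Y_2(\omega),\dots\}$ for almost all $\omega$. (Maps are considered up to almost sure equality.) The same definition applies to any other open interval in place of $(0,1)$. Two random dense countable sets $X_1:\Omega_1\to\mathrm{DCS}(0,1)$, $X_2:\Omega_2\to\mathrm{DCS}(0,1)$ are identically distributed if there is a joining $J$ of $\Omega_1,\Omega_2$ (a probability measure on $\Omega_1\times\Omega_2$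 whose marginals are the given probability measures) such that $X_1(\omega_1)=X_2(\omega_2)$ for $J$-almost all $(\omega_1,\omega_2)$. Finitely many random dense countable sets defined on the same probability space are independent if they admit independent measurable liftings (enumerations) on that probability space. Independence condition: $X$ satisfies $\mathbb{P}(t\in X)=0$ for each $t\in(0,1)$, and for all $n=1,2,\dots$ and all $0=t_0<t_1<\dots<t_n=1$ the random dense countable subsets $X_k=X\cap(t_{k-1},t_k)$ of $(t_{k-1},t_k)$, $k=1,\dots,n$, are independent. *)

theory Defs
  imports "HOL-Probability.Probability"
begin

subsection \<open>Standard (Lebesgue--Rokhlin) probability spaces\<close>

text \<open>
  The model spaces: an interval with Lebesgue measure, a finite or countable collection of atoms,
  or a combination of both. The interval is \<open>(0, c)\<close> and is empty if \<open>c = 0\<close>; the atoms sit at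
  the points \<open>0, -1, -2, \<dots>\<close>, outside the interval, and some or all of the masses \<open>p n\<close> may be zero.
\<close>

definition interval_with_atoms :: "real measure \<Rightarrow> bool" where
  "interval_with_atoms N \<longleftrightarrow> prob_space N \<and> sets N = sets borel \<and>
     (\<exists>c\<ge>0. \<exists>p :: nat \<Rightarrow> ennreal. \<forall>A\<in>sets borel.
        emeasure N A = emeasure lborel (A \<inter> {0<..<c}) + (\<Sum>n. p n * indicator A (- real n)))"

definition isomorphic_mod0 :: "'a measure \<Rightarrow> 'b measure \<Rightarrow> bool" where
  "isomorphic_mod0 M N \<longleftrightarrow>
     (\<exists>A\<in>sets M. \<exists>B\<in>sets N. \<exists>f g.
        space M - A \<in> null_sets M \<and> space N - B \<in> null_sets N \<and>
        f \<in> restrict_space M A \<rightarrow>\<^sub>M restrict_space N B \<and>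
        g \<in> restrict_space N B \<rightarrow>\<^sub>M restrict_space M A \<and>
        (\<forall>x\<in>A. g (f x) = x) \<and> (\<forall>y\<in>B. f (g y) = y) \<and>
        distr (restrict_space M A) (restrict_space N B) f = restrict_space N B)"

definition standard_prob_space :: "'a measure \<Rightarrow> bool" where
  "standard_prob_space M \<longleftrightarrow> prob_space M \<and> complete_measure M \<and>
     (\<exists>N. interval_with_atoms N \<and> isomorphic_mod0 M (completion N))"


subsection \<open>Random dense countable sets\<close>

text \<open>
  A point of \<open>DCS(a,b) = B/E\<close>, an equivalence class of enumerations up to permutation, is
  represented by the common set of values of these enumerations.
\<close>

definition DCS :: "real \<Rightarrow> real \<Rightarrow> real set set" where
  "DCS a b = {S. S \<subseteq> {a<..<b} \<and> countable S \<and> {a<..<b} \<subseteq> closure S}"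

definition distinct_seqs :: "real \<Rightarrow> real \<Rightarrow> (nat \<Rightarrow> real) measure" where
  "distinct_seqs a b =
     restrict_space (\<Pi>\<^sub>M k\<in>UNIV. borel) {y. inj y \<and> range y \<subseteq> {a<..<b}}"

definition measurable_enumeration ::
    "'a measure \<Rightarrow> real \<Rightarrow> real \<Rightarrow> ('a \<Rightarrow> real set) \<Rightarrow> ('a \<Rightarrow> nat \<Rightarrow> real) \<Rightarrow> bool" where
  "measurable_enumeration M a b X Y \<longleftrightarrow>
     Y \<in> M \<rightarrow>\<^sub>M distinct_seqs a b \<and> (AE \<omega> in M. X \<omega> = range (Y \<omega>))"

definition random_DCS :: "'a measure \<Rightarrow> real \<Rightarrow> real \<Rightarrow> ('a \<Rightarrow> real set) \<Rightarrow> bool" where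
  "random_DCS M a b X \<longleftrightarrow>
     X \<in> space M \<rightarrow> DCS a b \<and> (\<exists>Y. measurable_enumeration M a b X Y)"

definition identically_distributed_DCS ::
    "'a measure \<Rightarrow> ('a \<Rightarrow> real set) \<Rightarrow> 'b measure \<Rightarrow> ('b \<Rightarrow> real set) \<Rightarrow> bool" where
  "identically_distributed_DCS M1 X1 M2 X2 \<longleftrightarrow>
     (\<exists>J. prob_space J \<and> sets J = sets (M1 \<Otimes>\<^sub>M M2) \<and>
        distr J M1 fst = M1 \<and> distr J M2 snd = M2 \<and>
        (AE \<omega> in J. X1 (fst \<omega>) = X2 (snd \<omega>)))"

definition independent_DCS ::
    "'a measure \<Rightarrow> 'i set \<Rightarrow> ('i \<Rightarrow> real) \<Rightarrow> ('i \<Rightarrow> real) \<Rightarrow> ('i \<Rightarrow> 'a \<Rightarrow> real set) \<Rightarrow> bool" where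
  "independent_DCS M I a b X \<longleftrightarrow>
     (\<exists>Y. (\<forall>k\<in>I. measurable_enumeration M (a k) (b k) (X k) (Y k)) \<and>
        prob_space.indep_vars M (\<lambda>k. distinct_seqs (a k) (b k)) Y I)"

definition independence_condition :: "'a measure \<Rightarrow> ('a \<Rightarrow> real set) \<Rightarrow> bool" where
  "independence_condition M X \<longleftrightarrow>
     (\<forall>t\<in>{0<..<1}. AE \<omega> in M. t \<notin> X \<omega>) \<and>
     (\<forall>n\<ge>1. \<forall>t :: nat \<Rightarrow> real. t 0 = 0 \<and> t n = 1 \<and> (\<forall>k\<in>{1..n}. t (k - 1) < t k) \<longrightarrow>
        independent_DCS M {1..n} (\<lambda>k. t (k - 1)) t
          (\<lambda>k \<omega>. X \<omega> \<inter> {t (k - 1)<..<t k}))"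

end

theory Submission
  imports Defs
begin

text \<open>
  Why the distribution is determined. Let \<open>Y\<close> enumerate \<open>X\<close>. Condition on finitely many points
  \<open>z 0, \<dots>, z (n - 1)\<close> of \<open>X\<close>. On a rational interval that contains none of them, \<open>X\<close> is independent
  of these points, so there it still misses every null set and still meets every set of positive
  measure. Countably many such intervals cover the complement of \<open>z\<close>. Hence almost surely, for all
  finite tuples \<open>z\<close> of points of \<open>X\<close> at once, a further point of \<open>X\<close> lies in the section
  \<open>D z\<close> of a given measurable set \<open>D\<close> if and only if \<open>D z\<close> has positive measure
  (\<open>hit_dichotomy_if_independent\<close>).

  One half of this dichotomy says that the conditional distribution of a further point is absolutely
  continuous. The other half says that there are points of \<open>X\<close> in every set of positive measure that
  depends on \<open>z\<close>, and this suffices to select from \<open>X\<close> a point with any prescribed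
  absolutely continuous conditional distribution \<open>\<tau>\<close>. Offer the points of the enumeration one after
  the other, and accept each with the largest probability for which the accepted mass remains below
  \<open>\<tau>\<close>. Where the target is never exhausted every offered point is accepted with certainty. If
  a positive part of \<open>\<tau>\<close> were never used up, some offered point would fall into it and be accepted, so
  no probability would be left over, and then no mass of \<open>\<tau>\<close> would be left over either
  (\<open>greedy_thinning\<close>, \<open>random_choice\<close>).

  Two such random sets can therefore be enumerated back and forth. In turn, one side
  takes the first point of its own enumeration that is still missing, and the other side selects a
  point of its set with the same conditional distribution, given the points chosen so far. After each
  step the two finite sequences have the same distribution; in the limit both sets are exhausted by
  random sequences \<open>Za\<close> and \<open>Zb\<close> that have the same distribution
  (\<open>common_random_enumeration\<close>).

  A joining is obtained by identifying \<open>Za\<close> with \<open>Zb\<close>: starting from a sequence \<open>z\<close>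
  with their common distribution, a point of each of the two probability spaces is drawn according to its
  conditional distribution given \<open>z\<close>. This step uses that the probability spaces are standard
  (\<open>conditional_realization\<close>). Both sets are then the set of values of the same sequence.
\<close>

section \<open>The hitting dichotomy\<close>

abbreviation real_seqs :: "(nat \<Rightarrow> real) measure" where
  "real_seqs \<equiv> \<Pi>\<^sub>M k\<in>UNIV. borel"

text \<open>
  A tuple of \<open>n\<close> points is encoded as a sequence that vanishes from index \<open>n\<close> on, so that tuples of
  all lengths live in one measurable space. The quantifier over \<open>z\<close> is inside the almost sure statement:
  the tuple may depend on the random outcome in any way, even non-measurably.
\<close>

definition hit_dichotomy :: "'a measure \<Rightarrow> ('a \<Rightarrow> nat \<Rightarrow> real) \<Rightarrow> nat \<Rightarrow> ((nat \<Rightarrow> real) \<times> real) set \<Rightarrow> bool" where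
  "hit_dichotomy M Y n D \<longleftrightarrow>
     (AE \<omega> in M. \<forall>z. (\<forall>i<n. z i \<in> range (Y \<omega>)) \<and> (\<forall>i\<ge>n. z i = 0) \<longrightarrow>
        ((\<exists>x\<in>range (Y \<omega>) - z ` {..<n}. (z, x) \<in> D) \<longleftrightarrow>
         emeasure lborel {x\<in>{0<..<1}. (z, x) \<in> D} \<noteq> 0))"

lemma measurable_distinct_seqs_real_seqs:
  "f \<in> M \<rightarrow>\<^sub>M distinct_seqs a b \<Longrightarrow> f \<in> M \<rightarrow>\<^sub>M real_seqs"
  unfolding distinct_seqs_def by (rule measurable_restrict_space2_iff[THEN iffD1, THEN conjunct1])

lemma sections_measurable:
  assumes "D \<in> sets (S \<Otimes>\<^sub>M N)" "z \<in> space S" 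
  shows "{x\<in>space N. (z, x) \<in> D} \<in> sets N"
proof -
  have "{x\<in>space N. (z, x) \<in> D} = Pair z -` D"
    using sets.sets_into_space[OF assms(1)] by (auto simp: space_pair_measure)
  then show ?thesis using sets_Pair1[OF assms(1)] by simp
qed

text \<open>
  Points of \<open>X\<close> outside \<open>(p, q)\<close> are independent of the part of \<open>X\<close> inside. A tuple of them is one
  of countably many functions of the enumerations of the two outer parts, and for a fixed tuple the
  claim is the assumption on null sets and sets of positive measure; Fubini does the rest.
\<close>

lemma local_hit_dichotomy:
  fixes M :: "'a measure" and X :: "'a \<Rightarrow> real set"
  assumes "prob_space M" and indep: "independence_condition M X"
    and avoid: "\<And>A. A \<in> sets borel \<Longrightarrow> A \<subseteq> {0<..<1} \<Longrightarrow> emeasure lborel A = 0 \<Longrightarrow>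
           AE \<omega> in M. X \<omega> \<inter> A = {}"
    and hit: "\<And>A. A \<in> sets borel \<Longrightarrow> A \<subseteq> {0<..<1} \<Longrightarrow> emeasure lborel A > 0 \<Longrightarrow>
           AE \<omega> in M. infinite (X \<omega> \<inter> A)"
    and D[measurable]: "D \<in> sets (real_seqs \<Otimes>\<^sub>M borel)"
    and pq: "0 < p" "p < q" "q < 1"
  shows "AE \<omega> in M. \<forall>z. (\<forall>i<n. z i \<in> X \<omega> \<inter> ({0<..<p} \<union> {q<..<1})) \<and> (\<forall>i\<ge>n. z i = 0) \<longrightarrow>
    ((\<exists>x\<in>X \<omega> \<inter> {p<..<q}. (z, x) \<in> D) \<longleftrightarrow> emeasure lborel {x\<in>{p<..<q}. (z, x) \<in> D} \<noteq> 0)"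
proof -
  interpret M: prob_space M by fact
  define t :: "nat \<Rightarrow> real" where "t k = (if k = 0 then 0 else if k = 1 then p else if k = 2 then q else 1)" for k
  have interval: "{1..3::nat} = {1, 2, 3}" by auto
  have "t 0 = 0 \<and> t 3 = 1 \<and> (\<forall>k\<in>{1..3}. t (k - 1) < t k)"
    using pq by (auto simp: t_def interval)
  then have "independent_DCS M {1..3} (\<lambda>k. t (k - 1)) t (\<lambda>k \<omega>. X \<omega> \<inter> {t (k - 1)<..<t k})"
    using indep[unfolded independence_condition_def, THEN conjunct2, rule_format, of 3 t] by simp
  then obtain W where W: "\<And>k. k \<in> {1..3} \<Longrightarrow>
        measurable_enumeration M (t (k - 1)) (t k) (\<lambda>\<omega>. X \<omega> \<inter> {t (k - 1)<..<t k}) (W k)"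
    and W_indep: "M.indep_vars (\<lambda>k. distinct_seqs (t (k - 1)) (t k)) W {1..3}"
    unfolding independent_DCS_def by blast
  have range1: "AE \<omega> in M. X \<omega> \<inter> {0<..<p} = range (W 1 \<omega>)"
    and range2: "AE \<omega> in M. X \<omega> \<inter> {p<..<q} = range (W 2 \<omega>)"
    and range3: "AE \<omega> in M. X \<omega> \<inter> {q<..<1} = range (W 3 \<omega>)"
    using W[of 1] W[of 2] W[of 3] by (auto simp: measurable_enumeration_def t_def)
  have W2[measurable]: "W 2 \<in> M \<rightarrow>\<^sub>M real_seqs"
    using W[of 2] by (auto simp: measurable_enumeration_def intro: measurable_distinct_seqs_real_seqs)
  \<comment> \<open>The claim, for the points \<open>z\<close> outside and the enumeration \<open>w\<close> of the part inside the interval.\<close>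
  define \<Phi> where "\<Phi> z w \<longleftrightarrow>
    ((\<exists>k::nat. (z, w k) \<in> D) \<longleftrightarrow> emeasure lborel {x\<in>space lborel. x \<in> {p<..<q} \<and> (z, x) \<in> D} \<noteq> 0)"
    for z w :: "nat \<Rightarrow> real"
  have \<Phi>[measurable]: "Measurable.pred (real_seqs \<Otimes>\<^sub>M real_seqs) (\<lambda>(z, w). \<Phi> z w)"
  proof -
    have "{v\<in>space (real_seqs \<Otimes>\<^sub>M borel). p < snd v \<and> snd v < q \<and> v \<in> D} \<in> sets (real_seqs \<Otimes>\<^sub>M borel)"
      by measurable
    then have "(\<lambda>z. emeasure lborel {x\<in>space lborel. x \<in> {p<..<q} \<and> (z, x) \<in> D}) \<in> borel_measurable real_seqs"
      by (intro lborel.measurable_emeasure) (auto simp: space_pair_measure)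
    then show ?thesis unfolding \<Phi>_def by measurable
  qed
  have \<Phi>_section: "AE \<omega> in M. \<Phi> z (W 2 \<omega>)" for z
  proof -
    define A where "A = {x\<in>space lborel. x \<in> {p<..<q} \<and> (z, x) \<in> D}"
    have "z \<in> space real_seqs" by (simp add: space_PiM)
    then have A: "A \<in> sets borel" "A \<subseteq> {0<..<1}"
      using sections_measurable[OF D, of z] pq by (auto simp: A_def)
    have X_A: "X \<omega> \<inter> A = {} \<longleftrightarrow> \<not> (\<exists>k. (z, W 2 \<omega> k) \<in> D)"
      if "X \<omega> \<inter> {p<..<q} = range (W 2 \<omega>)" for \<omega>
    proof -
      have "X \<omega> \<inter> A = range (W 2 \<omega>) \<inter> {x. (z, x) \<in> D}"
        using that by (auto simp: A_def)
      then show ?thesis by auto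
    qed
    have \<Phi>_A: "\<Phi> z w \<longleftrightarrow> ((\<exists>k. (z, w k) \<in> D) \<longleftrightarrow> emeasure lborel A \<noteq> 0)" for w
      by (simp add: \<Phi>_def A_def)
    show ?thesis
    proof (cases "emeasure lborel A = 0")
      case True
      show ?thesis using avoid[OF A True] range2
      proof eventually_elim
        case (elim \<omega>)
        then show ?case using True X_A[OF elim(2)] by (simp add: \<Phi>_A)
      qed
    next
      case False
      then have "AE \<omega> in M. infinite (X \<omega> \<inter> A)" by (intro hit A) (simp add: zero_less_iff_neq_zero)
      then show ?thesis using range2
      proof eventually_elim
        case (elim \<omega>)
        then have "X \<omega> \<inter> A \<noteq> {}" by auto
        then show ?case using False X_A[OF elim(2)] by (simp add: \<Phi>_A)
      qed
    qed
  qed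
  \<comment> \<open>The tuple addressed by \<open>l\<close>: each entry names one of the outer parts and an index in its enumeration.\<close>
  define Z where "Z l \<omega> i = (if i < length l then W (if fst (l ! i) then 1 else 3) \<omega> (snd (l ! i)) else 0)"
    for l :: "(bool \<times> nat) list" and \<omega> i
  have \<Phi>_Z: "AE \<omega> in M. \<Phi> (Z l \<omega>) (W 2 \<omega>)" for l
  proof -
    let ?D = "\<lambda>k. distinct_seqs (t (k - 1)) (t k)"
    define F where "F v i = (if i < length l then v (if fst (l ! i) then 1 else 3 :: nat) (snd (l ! i)) else 0)"
      for v :: "nat \<Rightarrow> nat \<Rightarrow> real" and i
    have comp: "(\<lambda>v. v k) \<in> PiM I ?D \<rightarrow>\<^sub>M real_seqs" if "k \<in> I" for k I
      using measurable_component_singleton[of k I ?D] that by (intro measurable_distinct_seqs_real_seqs)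
    have comp2: "(\<lambda>v. v k j) \<in> borel_measurable (PiM I ?D)" if "k \<in> I" for k j I
      using measurable_compose[OF comp[OF that] measurable_component_singleton[of j UNIV]] by simp
    have F: "F \<in> PiM {1, 3} ?D \<rightarrow>\<^sub>M real_seqs"
    proof (rule measurable_PiM_single')
      fix i :: nat
      show "(\<lambda>v. F v i) \<in> borel_measurable (PiM {1, 3} ?D)"
        using comp2[of "if fst (l ! i) then 1 else 3" "{1, 3}" "snd (l ! i)"] by (simp add: F_def)
    qed (auto simp: space_PiM)
    have "M.indep_var (PiM {1, 3} ?D) (\<lambda>\<omega>. restrict (\<lambda>i. W i \<omega>) {1, 3})
      (PiM {2} ?D) (\<lambda>\<omega>. restrict (\<lambda>i. W i \<omega>) {2})"
      by (intro M.indep_var_restrict[OF W_indep]) auto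
    from M.indep_var_compose[OF this F comp[of 2 "{2}"]]
    have "M.indep_var real_seqs (F \<circ> (\<lambda>\<omega>. restrict (\<lambda>i. W i \<omega>) {1, 3})) real_seqs (W 2)"
      by (simp add: comp_def)
    moreover have "F \<circ> (\<lambda>\<omega>. restrict (\<lambda>i. W i \<omega>) {1, 3}) = Z l"
      by (auto simp: fun_eq_iff F_def Z_def)
    ultimately have "M.indep_var real_seqs (Z l) real_seqs (W 2)"
      by simp
    then have Z[measurable]: "Z l \<in> M \<rightarrow>\<^sub>M real_seqs" 
      and distr: "distr M (real_seqs \<Otimes>\<^sub>M real_seqs) (\<lambda>\<omega>. (Z l \<omega>, W 2 \<omega>)) =
        distr M real_seqs (Z l) \<Otimes>\<^sub>M distr M real_seqs (W 2)"
      by (auto simp: M.indep_var_distribution_eq)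
    interpret A: prob_space "distr M real_seqs (Z l)" by (rule M.prob_space_distr) simp
    interpret B: prob_space "distr M real_seqs (W 2)" by (rule M.prob_space_distr) simp
    interpret AB: pair_sigma_finite "distr M real_seqs (Z l)" "distr M real_seqs (W 2)" ..
    have "AE w in distr M real_seqs (W 2). \<Phi> z w" for z
    proof -
      have "Measurable.pred real_seqs (\<Phi> z)"
        using measurable_compose[OF measurable_Pair1'[of z real_seqs real_seqs] \<Phi>] by (simp add: space_PiM)
      then show ?thesis
        using \<Phi>_section[of z] by (subst AE_distr_iff) (auto simp: pred_def)
    qed
    moreover have "{v\<in>space (real_seqs \<Otimes>\<^sub>M real_seqs). \<Phi> (fst v) (snd v)} \<in> sets (real_seqs \<Otimes>\<^sub>M real_seqs)"
      using \<Phi> by (simp add: pred_def case_prod_beta)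
    ultimately have "AE v in distr M real_seqs (Z l) \<Otimes>\<^sub>M distr M real_seqs (W 2). case v of (z, w) \<Rightarrow> \<Phi> z w"
      by (intro AB.AE_pair_measure) (simp_all add: case_prod_beta space_pair_measure)
    then show ?thesis
      unfolding distr[symmetric] by (subst (asm) AE_distr_iff) auto
  qed
  have "AE \<omega> in M. \<forall>l. \<Phi> (Z l \<omega>) (W 2 \<omega>)"
    unfolding AE_all_countable using \<Phi>_Z by blast
  then show ?thesis
    using range1 range2 range3
  proof eventually_elim
    case (elim \<omega>)
    show ?case
    proof (intro allI impI)
      fix z assume z: "(\<forall>i<n. z i \<in> X \<omega> \<inter> ({0<..<p} \<union> {q<..<1})) \<and> (\<forall>i\<ge>n. z i = 0)"
      have "\<exists>c. z i = W (if fst c then 1 else 3) \<omega> (snd c)" if "i < n" for i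
      proof -
        have "z i \<in> range (W 1 \<omega>) \<or> z i \<in> range (W 3 \<omega>)"
          using z that elim by blast
        then obtain k where "z i = W 1 \<omega> k \<or> z i = W 3 \<omega> k" by blast
        then show ?thesis by (metis fst_conv snd_conv)
      qed
      then obtain c where c: "\<And>i. i < n \<Longrightarrow> z i = W (if fst (c i) then 1 else 3) \<omega> (snd (c i))" by metis
      have "z = Z (map c [0..<n]) \<omega>"
        using z c by (auto simp: Z_def fun_eq_iff not_less)
      then have "\<Phi> z (W 2 \<omega>)" using elim(1) by simp
      moreover have "(\<exists>x\<in>X \<omega> \<inter> {p<..<q}. (z, x) \<in> D) \<longleftrightarrow> (\<exists>k. (z, W 2 \<omega> k) \<in> D)"
        unfolding elim(3) by auto
      ultimately show "(\<exists>x\<in>X \<omega> \<inter> {p<..<q}. (z, x) \<in> D) \<longleftrightarrow>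
          emeasure lborel {x\<in>{p<..<q}. (z, x) \<in> D} \<noteq> 0"
        by (simp add: \<Phi>_def)
    qed
  qed
qed

lemma rational_interval_avoiding_finite:
  fixes F :: "real set"
  assumes "finite F" "x \<in> {0<..<1} - F"
  obtains p q where "p \<in> \<rat>" "q \<in> \<rat>" "0 < p" "p < x" "x < q" "q < 1" "F \<inter> {p..q} = {}"
proof -
  have "open ({0<..<1} - F)"
    using assms(1) by (intro open_Diff finite_imp_closed) auto
  then obtain e where e: "e > 0" "cball x e \<subseteq> {0<..<1} - F"
    using assms(2) open_contains_cball by blast
  obtain p where p: "p \<in> \<rat>" "x - e < p" "p < x" using Rats_dense_in_real[of "x - e" x] e by auto
  obtain q where q: "q \<in> \<rat>" "x < q" "q < x + e" using Rats_dense_in_real[of x "x + e"] e by auto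
  have "y \<in> {0<..<1} - F" if "y \<in> {p..q}" for y
    using that p q by (intro subsetD[OF e(2)]) (auto simp: dist_real_def)
  from this[of p] this[of q] this show thesis
    using p q by (intro that[of p q]) auto
qed

text \<open>
  Rational intervals whose closure avoids the tuple \<open>z\<close> cover \<open>(0, 1)\<close> up to the finitely many
  points of \<open>z\<close>, so the local dichotomies combine to a global one.
\<close>

lemma hit_dichotomy_if_independent:
  fixes M :: "'a measure" and X :: "'a \<Rightarrow> real set"
  assumes M: "prob_space M" "independence_condition M X"
    and avoid: "\<And>A. A \<in> sets borel \<Longrightarrow> A \<subseteq> {0<..<1} \<Longrightarrow> emeasure lborel A = 0 \<Longrightarrow>
           AE \<omega> in M. X \<omega> \<inter> A = {}"
    and hit: "\<And>A. A \<in> sets borel \<Longrightarrow> A \<subseteq> {0<..<1} \<Longrightarrow> emeasure lborel A > 0 \<Longrightarrow>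
           AE \<omega> in M. infinite (X \<omega> \<inter> A)"
    and Y: "measurable_enumeration M 0 1 X Y"
    and D[measurable]: "D \<in> sets (real_seqs \<Otimes>\<^sub>M borel)"
  shows "hit_dichotomy M Y n D"
proof -
  define R where "R = {(p, q). p \<in> \<rat> \<and> q \<in> \<rat> \<and> 0 < p \<and> p < q \<and> q < (1 :: real)}"
  have "R \<subseteq> \<rat> \<times> \<rat>" by (auto simp: R_def)
  then have "countable R" by (rule countable_subset) (simp add: countable_rat)
  have "AE \<omega> in M. \<forall>(p, q)\<in>R. \<forall>z. (\<forall>i<n. z i \<in> X \<omega> \<inter> ({0<..<p} \<union> {q<..<1})) \<and> (\<forall>i\<ge>n. z i = 0) \<longrightarrow>
    ((\<exists>x\<in>X \<omega> \<inter> {p<..<q}. (z, x) \<in> D) \<longleftrightarrow> emeasure lborel {x\<in>{p<..<q}. (z, x) \<in> D} \<noteq> 0)"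
    unfolding case_prod_beta
    by (intro AE_ball_countable[OF \<open>countable R\<close>, THEN iffD2] ballI local_hit_dichotomy[OF M avoid hit D])
       (auto simp: R_def)
  moreover have "AE \<omega> in M. X \<omega> = range (Y \<omega>)"
    using Y by (simp add: measurable_enumeration_def)
  moreover have "AE \<omega> in M. range (Y \<omega>) \<subseteq> {0<..<1}"
    using Y by (intro AE_I2) (auto simp: measurable_enumeration_def distinct_seqs_def
      measurable_restrict_space2_iff Pi_iff image_subset_iff)
  ultimately show ?thesis
    unfolding hit_dichotomy_def
  proof eventually_elim
    case (elim \<omega>)
    show ?case
    proof (intro allI impI)
      fix z assume z: "(\<forall>i<n. z i \<in> range (Y \<omega>)) \<and> (\<forall>i\<ge>n. z i = 0)"
      let ?F = "z ` {..<n}"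
      have D_z: "{x\<in>{a<..<b}. (z, x) \<in> D} \<in> sets lborel" for a b
      proof -
        have "{x\<in>space borel. (z, x) \<in> D} \<in> sets borel" by (intro sections_measurable[OF D]) (simp add: space_PiM)
        then have "{x\<in>space borel. (z, x) \<in> D} \<inter> {a<..<b} \<in> sets lborel" by auto
        also have "{x\<in>space borel. (z, x) \<in> D} \<inter> {a<..<b} = {x\<in>{a<..<b}. (z, x) \<in> D}" by auto
        finally show ?thesis .
      qed
      have loc: "(\<exists>x\<in>range (Y \<omega>) \<inter> {p<..<q}. (z, x) \<in> D) \<longleftrightarrow>
          emeasure lborel {x\<in>{p<..<q}. (z, x) \<in> D} \<noteq> 0" if "(p, q) \<in> R" "?F \<inter> {p..q} = {}" for p q
      proof -
        have "z i \<in> X \<omega> \<inter> ({0<..<p} \<union> {q<..<1})" if "i < n" for i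
        proof -
          have "z i \<notin> {p..q}" using that \<open>?F \<inter> {p..q} = {}\<close> by auto
          then show ?thesis using that z elim(2,3) by force
        qed
        then have "(\<exists>x\<in>X \<omega> \<inter> {p<..<q}. (z, x) \<in> D) \<longleftrightarrow> emeasure lborel {x\<in>{p<..<q}. (z, x) \<in> D} \<noteq> 0"
          using z by (intro bspec[OF elim(1) that(1), unfolded prod.case, THEN spec, THEN mp]) blast
        then show ?thesis unfolding elim(2) .
      qed
      show "(\<exists>x\<in>range (Y \<omega>) - ?F. (z, x) \<in> D) \<longleftrightarrow> emeasure lborel {x\<in>{0<..<1}. (z, x) \<in> D} \<noteq> 0"
      proof
        assume "\<exists>x\<in>range (Y \<omega>) - ?F. (z, x) \<in> D"
        then obtain x where x: "x \<in> range (Y \<omega>) - ?F" "(z, x) \<in> D" by blast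
        then have "x \<in> {0<..<1} - ?F" using elim(3) by auto
        then obtain p q where pq: "p \<in> \<rat>" "q \<in> \<rat>" "0 < p" "p < x" "x < q" "q < 1" "?F \<inter> {p..q} = {}"
          by (rule rational_interval_avoiding_finite[rotated]) auto
        then have "emeasure lborel {x\<in>{p<..<q}. (z, x) \<in> D} \<noteq> 0"
          using x by (subst loc[symmetric]) (auto simp: R_def)
        moreover have "emeasure lborel {x\<in>{p<..<q}. (z, x) \<in> D} \<le> emeasure lborel {x\<in>{0<..<1}. (z, x) \<in> D}"
          using pq by (intro emeasure_mono D_z) auto
        ultimately show "emeasure lborel {x\<in>{0<..<1}. (z, x) \<in> D} \<noteq> 0" by auto
      next
        assume pos: "emeasure lborel {x\<in>{0<..<1}. (z, x) \<in> D} \<noteq> 0"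
        let ?R = "{(p, q)\<in>R. ?F \<inter> {p..q} = {}}"
        have "\<exists>(p, q)\<in>?R. emeasure lborel {x\<in>{p<..<q}. (z, x) \<in> D} \<noteq> 0"
        proof (rule ccontr)
          assume "\<not> ?thesis"
          then have "(\<Union>(p, q)\<in>?R. {x\<in>{p<..<q}. (z, x) \<in> D}) \<in> null_sets lborel"
            using D_z by (intro null_sets_UN' countable_subset[OF _ \<open>countable R\<close>]) (auto simp: null_sets_def)
          moreover have "?F \<in> null_sets lborel"
            by (intro finite_imp_null_set_lborel) auto
          ultimately have N: "?F \<union> (\<Union>(p, q)\<in>?R. {x\<in>{p<..<q}. (z, x) \<in> D}) \<in> null_sets lborel" by auto
          have "{x\<in>{0<..<1}. (z, x) \<in> D} \<subseteq> ?F \<union> (\<Union>(p, q)\<in>?R. {x\<in>{p<..<q}. (z, x) \<in> D})"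
          proof
            fix x assume x: "x \<in> {x\<in>{0<..<1}. (z, x) \<in> D}"
            show "x \<in> ?F \<union> (\<Union>(p, q)\<in>?R. {x\<in>{p<..<q}. (z, x) \<in> D})"
            proof (cases "x \<in> ?F")
              case False
              then have "x \<in> {0<..<1} - ?F" using x by auto
              then obtain p q where "p \<in> \<rat>" "q \<in> \<rat>" "0 < p" "p < x" "x < q" "q < 1" "?F \<inter> {p..q} = {}"
                by (rule rational_interval_avoiding_finite[rotated]) auto
              then show ?thesis using x by (intro UnI2 UN_I[of "(p, q)"]) (auto simp: R_def)
            qed simp
          qed
          then show False
            using pos null_sets_subset[OF N D_z] by (auto simp: null_sets_def)
        qed
        then obtain p q where "(p, q) \<in> R" "?F \<inter> {p..q} = {}"
          "emeasure lborel {x\<in>{p<..<q}. (z, x) \<in> D} \<noteq> 0" by auto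
        then obtain x where x: "x \<in> range (Y \<omega>) \<inter> {p<..<q}" "(z, x) \<in> D"
          using loc by blast
        then have "x \<notin> ?F" using \<open>?F \<inter> {p..q} = {}\<close> by auto
        then show "\<exists>x\<in>range (Y \<omega>) - ?F. (z, x) \<in> D" using x by blast
      qed
    qed
  qed
qed

section \<open>Greedy thinning\<close>

lemma AE_le_if_nn_integral_le:
  assumes f[measurable]: "f \<in> borel_measurable M" and g[measurable]: "g \<in> borel_measurable M"
    and fin: "(\<integral>\<^sup>+x. g x \<partial>M) \<noteq> \<infinity>"
    and le: "\<And>A. A \<in> sets M \<Longrightarrow> (\<integral>\<^sup>+x. f x * indicator A x \<partial>M) \<le> (\<integral>\<^sup>+x. g x * indicator A x \<partial>M)"
  shows "AE x in M. f x \<le> g x"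
proof -
  define A where "A = {x\<in>space M. g x < f x}"
  have A[measurable]: "A \<in> sets M" by (simp add: A_def)
  have "(\<integral>\<^sup>+x. g x * indicator A x \<partial>M) \<le> (\<integral>\<^sup>+x. g x \<partial>M)"
    by (intro nn_integral_mono) (auto split: split_indicator)
  then have fin': "(\<integral>\<^sup>+x. g x * indicator A x \<partial>M) < \<infinity>"
    using fin by (auto simp: less_top top_unique)
  have "(\<integral>\<^sup>+x. f x * indicator A x - g x * indicator A x \<partial>M) =
      (\<integral>\<^sup>+x. f x * indicator A x \<partial>M) - (\<integral>\<^sup>+x. g x * indicator A x \<partial>M)"
    using fin' by (intro nn_integral_diff) (auto simp: A_def less_imp_le split: split_indicator)
  also have "\<dots> = 0"
    using le[OF A] fin' by (simp add: diff_eq_0_iff_ennreal)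
  finally have "AE x in M. f x * indicator A x - g x * indicator A x = 0"
    by (subst (asm) nn_integral_0_iff_AE) auto
  then show ?thesis
    using AE_space
  proof eventually_elim
    case (elim x)
    then show ?case
      by (auto simp: A_def diff_eq_0_iff_ennreal not_less[symmetric] split: split_indicator_asm)
  qed
qed

text \<open>
  One offer of the greedy selection: mass \<open>\<eta>\<close> is offered, \<open>\<tau>\<close> is still wanted, and the accepted part is
  the minimum of the two measures, with \<open>p\<close> its density with respect to \<open>\<eta>\<close>. What is still wanted
  afterwards, \<open>\<rho>\<close>, lives where the offer was accepted completely. On a Hahn set on which \<open>\<tau>\<close> is
  the larger measure, \<open>p\<close> is \<open>1\<close>; on the complement it is the density of \<open>\<tau>\<close>.
\<close>

lemma partial_absorption:
  fixes \<eta> \<tau> :: "'t measure"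
  assumes "finite_measure \<eta>" "finite_measure \<tau>" and [simp]: "sets \<tau> = sets \<eta>"
  obtains p :: "'t \<Rightarrow> ennreal" and \<rho> :: "'t measure"
  where "p \<in> borel_measurable \<eta>" "\<And>x. p x \<le> 1" "finite_measure \<rho>" "sets \<rho> = sets \<eta>"
    "\<And>B. B \<in> sets \<eta> \<Longrightarrow> emeasure \<tau> B = emeasure \<rho> B + (\<integral>\<^sup>+x. p x * indicator B x \<partial>\<eta>)"
    "emeasure \<rho> {x\<in>space \<eta>. p x \<noteq> 1} = 0"
proof -
  interpret \<eta>: finite_measure \<eta> by fact
  interpret \<tau>: finite_measure \<tau> by fact
  have [simp]: "space \<tau> = space \<eta>" by (rule sets_eq_imp_space_eq) simp
  obtain P where P[measurable]: "P \<in> sets \<eta>"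
    and big: "\<And>X. X \<in> sets \<eta> \<Longrightarrow> X \<subseteq> P \<Longrightarrow> emeasure \<eta> X \<le> emeasure \<tau> X"
    and small: "\<And>X. X \<in> sets \<eta> \<Longrightarrow> X \<inter> P = {} \<Longrightarrow> emeasure \<tau> X \<le> emeasure \<eta> X"
    using finite_unsigned_Hahn_decomposition[OF assms(2,1)] by auto
  define \<tau>' where "\<tau>' = density \<tau> (indicator (space \<eta> - P))"
  have [measurable]: "space \<eta> - P \<in> sets \<tau>" by simp
  have sets_\<tau>'[simp]: "sets \<tau>' = sets \<eta>" by (simp add: \<tau>'_def)
  have emeasure_\<tau>': "emeasure \<tau>' B = emeasure \<tau> (B - P)" if "B \<in> sets \<eta>" for B
  proof -
    have "(\<integral>\<^sup>+x. indicator (space \<eta> - P) x * indicator B x \<partial>\<tau>) = (\<integral>\<^sup>+x. indicator (B - P) x \<partial>\<tau>)"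
      using that by (intro nn_integral_cong) (auto split: split_indicator dest: sets.sets_into_space)
    then show ?thesis
      using that by (simp add: \<tau>'_def emeasure_density)
  qed
  have "absolutely_continuous \<eta> \<tau>'"
    unfolding absolutely_continuous_def
  proof
    fix N assume N: "N \<in> null_sets \<eta>"
    then have "emeasure \<tau> (N - P) \<le> emeasure \<eta> (N - P)"
      by (intro small) auto
    also have "\<dots> \<le> emeasure \<eta> N"
      using N by (intro emeasure_mono) auto
    finally show "N \<in> null_sets \<tau>'"
      using N emeasure_\<tau>'[of N] by (auto simp: null_sets_def)
  qed
  then obtain f where f[measurable]: "f \<in> borel_measurable \<eta>" and f_eq: "density \<eta> f = \<tau>'"
    using \<eta>.Radon_Nikodym[OF _ sets_\<tau>'] by auto
  have int_f: "(\<integral>\<^sup>+x. f x * indicator B x \<partial>\<eta>) = emeasure \<tau> (B - P)" if "B \<in> sets \<eta>" for B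
    using that emeasure_\<tau>'[OF that] by (simp flip: f_eq add: emeasure_density)
  have f_le: "AE x in \<eta>. f x \<le> 1"
  proof (rule AE_le_if_nn_integral_le)
    fix A assume A: "A \<in> sets \<eta>"
    have "emeasure \<tau> (A - P) \<le> emeasure \<eta> (A - P)"
      using A by (intro small) auto
    also have "\<dots> \<le> emeasure \<eta> A" using A by (intro emeasure_mono) auto
    finally show "(\<integral>\<^sup>+x. f x * indicator A x \<partial>\<eta>) \<le> (\<integral>\<^sup>+x. 1 * indicator A x \<partial>\<eta>)"
      using A by (simp add: int_f)
  qed (use \<eta>.emeasure_finite[of "space \<eta>"] in auto)
  define p where "p x = (if x \<in> P then 1 else min 1 (f x))" for x
  have p[measurable]: "p \<in> borel_measurable \<eta>" unfolding p_def by measurable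
  have int_p: "(\<integral>\<^sup>+x. p x * indicator B x \<partial>\<eta>) = emeasure \<eta> (B \<inter> P) + emeasure \<tau> (B - P)"
    if B[measurable]: "B \<in> sets \<eta>" for B
  proof -
    have "(\<integral>\<^sup>+x. p x * indicator B x \<partial>\<eta>) = (\<integral>\<^sup>+x. indicator (B \<inter> P) x + f x * indicator (B - P) x \<partial>\<eta>)"
      using f_le by (intro nn_integral_cong_AE) (auto simp: p_def min_def split: split_indicator)
    also have "\<dots> = emeasure \<eta> (B \<inter> P) + emeasure \<tau> (B - P)"
      by (subst nn_integral_add) (auto simp: int_f)
    finally show ?thesis .
  qed
  define \<alpha> where "\<alpha> = density \<eta> p"
  have [simp]: "sets \<alpha> = sets \<eta>" by (simp add: \<alpha>_def)
  have \<alpha>: "emeasure \<alpha> B = emeasure \<eta> (B \<inter> P) + emeasure \<tau> (B - P)" if "B \<in> sets \<eta>" for B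
    using that by (simp add: \<alpha>_def emeasure_density int_p)
  have \<tau>_split: "emeasure \<tau> B = emeasure \<tau> (B \<inter> P) + emeasure \<tau> (B - P)" if "B \<in> sets \<eta>" for B
    using that by (subst plus_emeasure) (auto intro!: arg_cong[where f="emeasure \<tau>"])
  have le: "emeasure \<alpha> B \<le> emeasure \<tau> B" if "B \<in> sets \<eta>" for B
    using that big[of "B \<inter> P"] by (auto simp: \<alpha> \<tau>_split[OF that] intro!: add_right_mono)
  have fin\<alpha>: "finite_measure \<alpha>"
    using le[of "space \<eta>"] \<tau>.emeasure_finite[of "space \<eta>"]
    by (intro finite_measureI) (auto simp: \<alpha>_def top_unique)
  define \<rho> where "\<rho> = diff_measure \<tau> \<alpha>"
  have \<rho>: "emeasure \<rho> B = emeasure \<tau> B - emeasure \<alpha> B" if "B \<in> sets \<eta>" for B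
    unfolding \<rho>_def using that le by (intro emeasure_diff_measure assms fin\<alpha>) auto
  show ?thesis
  proof (rule that[of p \<rho>])
    show "sets \<rho> = sets \<eta>" by (simp add: \<rho>_def)
    then have "space \<rho> = space \<eta>" by (rule sets_eq_imp_space_eq)
    then show "finite_measure \<rho>"
      using \<rho>[of "space \<eta>"] \<tau>.emeasure_finite[of "space \<eta>"]
      by (intro finite_measureI) (auto simp: top_unique ennreal_minus_eq_top)
    show "p x \<le> 1" for x by (simp add: p_def)
    show "emeasure \<tau> B = emeasure \<rho> B + (\<integral>\<^sup>+x. p x * indicator B x \<partial>\<eta>)" if "B \<in> sets \<eta>" for B
      using \<rho>[OF that] le[OF that] \<alpha>[OF that] int_p[OF that] by (simp add: diff_add_cancel_ennreal)
    define B where "B = {x\<in>space \<eta>. p x \<noteq> 1}"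
    have B: "B \<in> sets \<eta>" "B \<inter> P = {}" "B - P = B" unfolding B_def by (auto simp: p_def)
    then show "emeasure \<rho> {x\<in>space \<eta>. p x \<noteq> 1} = 0"
      by (simp add: \<rho> \<alpha> B_def[symmetric])
  qed (fact p)
qed

text \<open>
  \<open>V 0, V 1, \<dots>\<close> are offered in turn, and \<open>V k\<close> is accepted with probability \<open>p k (V k)\<close> if none of
  the previous ones was. The accepted random element then has distribution \<open>\<tau>\<close>. In the assumption \<open>hit\<close> the set
  \<open>C\<close> collects the conditions under which \<open>D\<close> has positive conditional probability for \<open>\<tau>\<close>. It depends on the
  part that all \<open>V k\<close> have in common, and that part is distributed as \<open>\<tau>\<close> wants it.

  The reason: let \<open>D\<close> be the set where all offers are accepted with certainty. The part of \<open>\<tau>\<close>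
  that is never used up lives on \<open>D\<close>, hence on \<open>C\<close>. But on \<open>C\<close> some offer falls into \<open>D\<close> and ends the
  selection, so over \<open>C\<close> the mass that is never assigned, which equals the mass of \<open>\<tau>\<close> that is
  never used up, is zero.
\<close>

lemma greedy_thinning:
  fixes Q :: "'q measure" and T :: "'t measure" and V :: "nat \<Rightarrow> 'q \<Rightarrow> 't"
  assumes "prob_space Q" "finite_measure \<tau>" and sets_\<tau>: "sets \<tau> = sets T"
    and V[measurable]: "\<And>k. V k \<in> Q \<rightarrow>\<^sub>M T"
    and hit: "\<And>D. D \<in> sets T \<Longrightarrow> \<exists>C\<in>sets T. emeasure \<tau> (D - C) = 0 \<and>
      emeasure \<tau> C = emeasure Q {q\<in>space Q. V 0 q \<in> C} \<and>
      (AE q in Q. (\<forall>k. V k q \<in> C \<longleftrightarrow> V 0 q \<in> C) \<and> (V 0 q \<in> C \<longrightarrow> (\<exists>k. V k q \<in> D)))"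
  obtains p :: "nat \<Rightarrow> 't \<Rightarrow> ennreal"
  where "\<And>k. p k \<in> borel_measurable T" "\<And>k x. p k x \<le> 1"
    "\<And>B. B \<in> sets T \<Longrightarrow> emeasure \<tau> B =
       (\<Sum>k. \<integral>\<^sup>+q. (\<Prod>j<k. 1 - p j (V j q)) * p k (V k q) * indicator B (V k q) \<partial>Q)"
proof -
  interpret Q: prob_space Q by fact
  interpret \<tau>: finite_measure \<tau> by fact
  have [simp]: "space \<tau> = space T" by (rule sets_eq_imp_space_eq) (rule sets_\<tau>)
  \<comment> \<open>A state consists of the probability \<open>r\<close> that nothing is accepted yet and the mass \<open>t\<close> still wanted.\<close>
  define good where "good n s = (case s of (r, t) \<Rightarrow>
      r \<in> borel_measurable Q \<and> (\<forall>q. r q \<le> 1) \<and> finite_measure t \<and> sets t = sets T \<and>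
      (n = 0 \<longrightarrow> r = (\<lambda>_. 1) \<and> t = \<tau>))" for n :: nat and s :: "('q \<Rightarrow> ennreal) \<times> 't measure"
  define step where "step n s s' = (case s of (r, t) \<Rightarrow> case s' of (r', t') \<Rightarrow>
      \<exists>p\<in>borel_measurable T. (\<forall>x. p x \<le> 1) \<and> r' = (\<lambda>q. r q * (1 - p (V n q))) \<and>
        (\<forall>B\<in>sets T. emeasure t B = emeasure t' B + (\<integral>\<^sup>+q. r q * p (V n q) * indicator B (V n q) \<partial>Q)) \<and>
        emeasure t' {x\<in>space T. p x \<noteq> 1} = 0)"
    for n :: nat and s s' :: "('q \<Rightarrow> ennreal) \<times> 't measure"
  have "\<exists>f. \<forall>n. good n (f n) \<and> step n (f n) (f (Suc n))"
  proof (rule dependent_nat_choice)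
    show "\<exists>s. good 0 s"
      by (rule exI[of _ "(\<lambda>_. 1, \<tau>)"]) (auto simp: good_def sets_\<tau> assms)
  next
    fix s n assume "good n s"
    then obtain r t where s: "s = (r, t)" and r[measurable]: "r \<in> borel_measurable Q" and r1: "\<And>q. r q \<le> 1"
      and t: "finite_measure t" "sets t = sets T"
      by (auto simp: good_def split: prod.splits)
    define \<eta> where "\<eta> = distr (density Q r) T (V n)"
    have [simp]: "sets \<eta> = sets T" "space \<eta> = space T" by (simp_all add: \<eta>_def)
    have "emeasure \<eta> (space \<eta>) = (\<integral>\<^sup>+q. r q * indicator (V n -` space T \<inter> space Q) q \<partial>Q)"
      by (simp add: \<eta>_def emeasure_distr emeasure_density)
    also have "\<dots> \<le> (\<integral>\<^sup>+q. 1 \<partial>Q)"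
      using r1 by (intro nn_integral_mono) (auto split: split_indicator)
    also have "\<dots> = 1"
      by (simp add: Q.emeasure_space_1)
    finally have "finite_measure \<eta>"
      by (intro finite_measureI) (auto simp: top_unique)
    then obtain p \<rho> where p[measurable]: "p \<in> borel_measurable \<eta>" and p1: "\<And>x. p x \<le> 1"
      and \<rho>: "finite_measure \<rho>" "sets \<rho> = sets \<eta>"
      and t_eq: "\<And>B. B \<in> sets \<eta> \<Longrightarrow> emeasure t B = emeasure \<rho> B + (\<integral>\<^sup>+x. p x * indicator B x \<partial>\<eta>)"
      and \<rho>0: "emeasure \<rho> {x\<in>space \<eta>. p x \<noteq> 1} = 0"
      by (rule partial_absorption[OF _ t(1)]) (auto simp: t)
    have [measurable]: "p \<in> borel_measurable T"
      using p by (simp cong: measurable_cong_sets)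
    have int: "(\<integral>\<^sup>+x. p x * indicator B x \<partial>\<eta>) = (\<integral>\<^sup>+q. r q * p (V n q) * indicator B (V n q) \<partial>Q)"
      if [measurable]: "B \<in> sets T" for B
      by (simp add: \<eta>_def nn_integral_distr nn_integral_density mult.assoc)
    have "r q * (1 - p (V n q)) \<le> 1" for q
      using mult_mono[of "r q" 1 "1 - p (V n q)" 1] r1[of q] by simp
    then have "good (Suc n) (\<lambda>q. r q * (1 - p (V n q)), \<rho>)"
      using \<rho> by (auto simp: good_def)
    moreover have "step n s (\<lambda>q. r q * (1 - p (V n q)), \<rho>)"
      unfolding step_def s using p1 t_eq \<rho>0 int by (auto intro!: bexI[of _ p])
    ultimately show "\<exists>s'. good (Suc n) s' \<and> step n s s'" by blast
  qed
  then obtain f where f: "\<And>n. good n (f n)" "\<And>n. step n (f n) (f (Suc n))" by blast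
  define r where "r n = fst (f n)" for n
  define t where "t n = snd (f n)" for n
  have r[measurable]: "r n \<in> borel_measurable Q" and r1: "r n q \<le> 1"
    and fin_t: "finite_measure (t n)" and sets_t[simp]: "sets (t n) = sets T" for n q
    using f(1)[of n] by (auto simp: good_def r_def t_def split: prod.splits)
  have r0: "r 0 = (\<lambda>_. 1)" and t0: "t 0 = \<tau>"
    using f(1)[of 0] by (auto simp: good_def r_def t_def split: prod.splits)
  have "\<exists>p. \<forall>n. p n \<in> borel_measurable T \<and> (\<forall>x. p n x \<le> 1) \<and>
        r (Suc n) = (\<lambda>q. r n q * (1 - p n (V n q))) \<and>
        (\<forall>B\<in>sets T. emeasure (t n) B =
           emeasure (t (Suc n)) B + (\<integral>\<^sup>+q. r n q * p n (V n q) * indicator B (V n q) \<partial>Q)) \<and>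
        emeasure (t (Suc n)) {x\<in>space T. p n x \<noteq> 1} = 0"
    using f(2) unfolding step_def r_def t_def case_prod_unfold Bex_def by (intro choice allI)
  then obtain p where p[measurable]: "\<And>n. p n \<in> borel_measurable T" and p1: "\<And>n x. p n x \<le> 1"
    and r_Suc: "\<And>n. r (Suc n) = (\<lambda>q. r n q * (1 - p n (V n q)))"
    and t_Suc: "\<And>n B. B \<in> sets T \<Longrightarrow> emeasure (t n) B =
           emeasure (t (Suc n)) B + (\<integral>\<^sup>+q. r n q * p n (V n q) * indicator B (V n q) \<partial>Q)"
    and t_null: "\<And>n. emeasure (t (Suc n)) {x\<in>space T. p n x \<noteq> 1} = 0"
    by blast
  have r_prod: "r n q = (\<Prod>j<n. 1 - p j (V j q))" for n q
    by (induction n) (auto simp: r0 r_Suc)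
  define a where "a n B = (\<integral>\<^sup>+q. r n q * p n (V n q) * indicator B (V n q) \<partial>Q)" for n B
  have split: "emeasure \<tau> B = emeasure (t n) B + (\<Sum>j<n. a j B)" if "B \<in> sets T" for n B
  proof (induction n)
    case (Suc n)
    then show ?case unfolding t_Suc[OF that, of n] by (simp add: a_def ac_simps)
  qed (simp add: t0)
  have t_le: "emeasure (t n) B \<le> emeasure \<tau> B" if "B \<in> sets T" for n B
    unfolding split[OF that, of n] by simp
  have t_anti: "emeasure (t n) B \<le> emeasure (t m) B" if "m \<le> n" "B \<in> sets T" for n m B
    using that(1)
  proof (induction rule: dec_induct)
    case (step n)
    have "emeasure (t (Suc n)) B \<le> emeasure (t n) B" unfolding t_Suc[OF that(2), of n] by simp
    then show ?case using step.IH by (rule order_trans)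
  qed simp
  define D where "D = {x\<in>space T. \<forall>k. p k x = 1}"
  have [measurable]: "D \<in> sets T" unfolding D_def by measurable
  obtain C where C[measurable]: "C \<in> sets T" and DC: "emeasure \<tau> (D - C) = 0"
    and \<tau>C: "emeasure \<tau> C = emeasure Q {q\<in>space Q. V 0 q \<in> C}"
    and aeC: "AE q in Q. (\<forall>k. V k q \<in> C \<longleftrightarrow> V 0 q \<in> C) \<and> (V 0 q \<in> C \<longrightarrow> (\<exists>k. V k q \<in> D))"
    using hit[of D] by auto
  define E where "E = {q\<in>space Q. V 0 q \<in> C}"
  have [measurable]: "E \<in> sets Q" unfolding E_def by measurable
  have a_C: "a n C = (\<integral>\<^sup>+q. r n q * p n (V n q) * indicator E q \<partial>Q)" for n
  proof -
    have "AE q in Q. r n q * p n (V n q) * indicator C (V n q) = r n q * p n (V n q) * indicator E q"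
      using aeC AE_space by eventually_elim (auto simp: E_def split: split_indicator)
    then show ?thesis unfolding a_def by (rule nn_integral_cong_AE)
  qed
  \<comment> \<open>The probability of \<open>E\<close> consists of what is still undecided and what has been assigned over \<open>C\<close>.\<close>
  have mass: "emeasure Q E = (\<integral>\<^sup>+q. r n q * indicator E q \<partial>Q) + (\<Sum>j<n. a j C)" for n
  proof (induction n)
    case (Suc n)
    have "r n q * indicator E q = r (Suc n) q * indicator E q + r n q * p n (V n q) * indicator E q" for q
    proof -
      have "r n q = r n q * ((1 - p n (V n q)) + p n (V n q))"
        using p1[of n "V n q"] by (simp add: diff_add_cancel_ennreal)
      also have "\<dots> = r (Suc n) q + r n q * p n (V n q)"
        by (simp add: r_Suc distrib_left)
      finally show ?thesis by (auto split: split_indicator)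
    qed
    then have "(\<integral>\<^sup>+q. r n q * indicator E q \<partial>Q) = (\<integral>\<^sup>+q. r (Suc n) q * indicator E q \<partial>Q) + a n C"
      unfolding a_C by (subst nn_integral_add[symmetric]) auto
    then show ?case using Suc by (simp add: ac_simps)
  qed (simp add: r0)
  have "(\<Sum>j<n. a j C) < \<top>" for n
    using mass[of n] Q.emeasure_finite[of E] by (auto simp: less_top)
  then have t_C: "emeasure (t n) C = (\<integral>\<^sup>+q. r n q * indicator E q \<partial>Q)" for n
  proof -
    have "(\<Sum>j<n. a j C) + emeasure (t n) C = (\<Sum>j<n. a j C) + (\<integral>\<^sup>+q. r n q * indicator E q \<partial>Q)"
      using mass[of n] split[OF C, of n] \<tau>C unfolding E_def[symmetric] by (metis add.commute)
    then show ?thesis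
      using \<open>(\<Sum>j<n. a j C) < \<top>\<close> unfolding ennreal_add_left_cancel infinity_ennreal_def
      by (metis less_irrefl)
  qed
  have "(\<lambda>n. \<integral>\<^sup>+q. r n q * indicator E q \<partial>Q) \<longlonglongrightarrow> (\<integral>\<^sup>+q. 0 \<partial>Q)"
  proof (rule nn_integral_dominated_convergence[where w="\<lambda>_. 1"])
    show "AE q in Q. r n q * indicator E q \<le> 1" for n
      using r1 by (auto split: split_indicator)
    show "AE q in Q. (\<lambda>n. r n q * indicator E q) \<longlonglongrightarrow> 0"
      using aeC
    proof eventually_elim
      case (elim q)
      show ?case
      proof (cases "q \<in> E")
        case True
        then obtain k where "V k q \<in> D" using elim by (auto simp: E_def)
        then have "p k (V k q) = 1" by (auto simp: D_def)
        then have "r n q = 0" if "n > k" for n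
          using that unfolding r_prod by (auto intro!: bexI[of _ k])
        then have "eventually (\<lambda>n. r n q * indicator E q = 0) sequentially"
          by (intro eventually_mono[OF eventually_gt_at_top[of k]]) simp
        then show ?thesis by (rule tendsto_eventually)
      qed simp
    qed
  qed (auto simp: Q.emeasure_space_1)
  then have lim_C: "(\<lambda>n. emeasure (t n) C) \<longlonglongrightarrow> 0"
    by (simp add: t_C)
  \<comment> \<open>After \<open>n\<close> offers the mass still wanted lives on \<open>D \<union> W n\<close>, and \<open>W n\<close> decreases to the empty set.\<close>
  define W where "W n = {x\<in>space T. (\<forall>j<n. p j x = 1) \<and> x \<notin> D}" for n
  have [measurable]: "W n \<in> sets T" for n unfolding W_def by measurable
  have "(\<lambda>n. emeasure \<tau> (W n)) \<longlonglongrightarrow> emeasure \<tau> (\<Inter>n. W n)"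
    using \<tau>.emeasure_finite by (intro Lim_emeasure_decseq) (auto simp: decseq_def W_def sets_\<tau>)
  moreover have "(\<Inter>n. W n) = {}" by (auto simp: W_def D_def)
  ultimately have lim_W: "(\<lambda>n. emeasure \<tau> (W n)) \<longlonglongrightarrow> 0" by simp
  have cover: "emeasure (t n) (space T) \<le> emeasure (t n) C + emeasure \<tau> (W n)" for n
  proof -
    define Z where "Z j = {x\<in>space T. p j x \<noteq> 1}" for j
    have [measurable]: "Z j \<in> sets T" for j unfolding Z_def by measurable
    have "emeasure (t n) (Z j) = 0" if "j < n" for j
      using t_anti[of "Suc j" n "Z j"] that t_null[of j] by (simp add: Z_def)
    then have "(\<Union>j<n. Z j) \<in> null_sets (t n)"
      by (intro null_sets_UN') (auto simp: null_sets_def)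
    moreover have "D - C \<in> null_sets (t n)"
      using t_le[of "D - C" n] DC by (auto simp: null_sets_def)
    ultimately have N: "(\<Union>j<n. Z j) \<union> (D - C) \<in> null_sets (t n)" by (rule null_sets.Un)
    have "emeasure (t n) (space T) \<le> emeasure (t n) ((C \<union> W n) \<union> ((\<Union>j<n. Z j) \<union> (D - C)))"
      by (intro emeasure_mono) (auto simp: W_def Z_def)
    also have "\<dots> = emeasure (t n) (C \<union> W n)"
      using N by (intro emeasure_Un_null_set) auto
    also have "\<dots> \<le> emeasure (t n) C + emeasure (t n) (W n)"
      by (intro emeasure_subadditive) auto
    also have "\<dots> \<le> emeasure (t n) C + emeasure \<tau> (W n)"
      by (intro add_left_mono t_le) auto
    finally show ?thesis .
  qed
  have lim_t: "(\<lambda>n. emeasure (t n) B) \<longlonglongrightarrow> 0" if "B \<in> sets T" for B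
  proof (rule tendsto_sandwich[OF _ _ tendsto_const])
    show "(\<lambda>n. emeasure (t n) C + emeasure \<tau> (W n)) \<longlonglongrightarrow> 0"
      using tendsto_add[OF lim_C lim_W] by simp
    have "emeasure (t n) B \<le> emeasure (t n) (space T)" for n
      using that sets_eq_imp_space_eq[OF sets_t[of n]] by (metis emeasure_space)
    then show "\<forall>\<^sub>F n in sequentially. emeasure (t n) B \<le> emeasure (t n) C + emeasure \<tau> (W n)"
      by (intro always_eventually allI order_trans[OF _ cover])
  qed simp
  show ?thesis
  proof (rule that[OF p p1])
    fix B assume B: "B \<in> sets T"
    have "(\<lambda>n. emeasure (t n) B + (\<Sum>j<n. a j B)) \<longlonglongrightarrow> 0 + (\<Sum>j. a j B)"
      by (intro tendsto_add lim_t B summable_LIMSEQ) simp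
    moreover have "(\<lambda>n. emeasure (t n) B + (\<Sum>j<n. a j B)) \<longlonglongrightarrow> emeasure \<tau> B"
      by (simp add: split[OF B, symmetric])
    ultimately have "emeasure \<tau> B = (\<Sum>j. a j B)"
      using LIMSEQ_unique by fastforce
    then show "emeasure \<tau> B =
       (\<Sum>k. \<integral>\<^sup>+q. (\<Prod>j<k. 1 - p j (V j q)) * p k (V k q) * indicator B (V k q) \<partial>Q)"
      by (simp add: a_def r_prod)
  qed
qed

section \<open>Random choice by uniform noise\<close>

definition unif :: "real measure" where
  "unif = uniform_measure lborel {0<..<1}"

lemma sets_unif[measurable_cong, simp]: "sets unif = sets borel"
  and space_unif[simp]: "space unif = UNIV"
  by (simp_all add: unif_def)

interpretation unif: prob_space unif
  unfolding unif_def by (rule prob_space_uniform_measure) simp_all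

lemma emeasure_unif_interval:
  assumes "a \<le> b" "b \<le> 1"
  shows "emeasure unif {v. a \<le> ennreal v \<and> ennreal v < b} = b - a"
proof -
  obtain \<alpha> \<beta> where ab: "a = ennreal \<alpha>" "b = ennreal \<beta>" "0 \<le> \<alpha>" "0 \<le> \<beta>"
    using assms by (metis ennreal_cases ennreal_one_neq_top neq_top_trans order.trans)
  with assms have le: "\<alpha> \<le> \<beta>" "\<beta> \<le> 1" by auto
  let ?S = "{0<..<1} \<inter> {v. a \<le> ennreal v \<and> ennreal v < b}"
  have [measurable]: "?S \<in> sets lborel" by measurable
  have "emeasure lborel {\<alpha><..<\<beta>} \<le> emeasure lborel ?S"
    using ab le by (intro emeasure_mono) (auto simp: ennreal_less_iff)
  moreover have "emeasure lborel ?S \<le> emeasure lborel {\<alpha>..\<beta>}"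
    using ab le by (intro emeasure_mono) (auto simp: ennreal_less_iff ennreal_le_iff)
  ultimately have "emeasure lborel ?S = ennreal (\<beta> - \<alpha>)"
    using le by simp
  also have "\<dots> = b - a" using ab by (simp add: ennreal_minus)
  finally show ?thesis by (simp add: unif_def divide_ennreal_def)
qed

lemma prob_measure_eqI_le:
  assumes "prob_space M" "prob_space N" and sets: "sets M = sets N"
    and le: "\<And>A. A \<in> sets M \<Longrightarrow> emeasure M A \<le> emeasure N A"
  shows "M = N"
proof (rule measure_eqI[OF sets])
  interpret M: prob_space M by fact
  interpret N: prob_space N by fact
  fix A assume A: "A \<in> sets M"
  have sp: "space M = space N" by (rule sets_eq_imp_space_eq) fact
  have "M.prob A \<le> N.prob A" "M.prob (space M - A) \<le> N.prob (space N - A)"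
    using le[of A] le[OF sets.compl_sets[OF A]] A sp by (auto simp: M.emeasure_eq_measure N.emeasure_eq_measure)
  then have "M.prob A = N.prob A"
    using A sets by (simp add: M.prob_compl N.prob_compl)
  then show "emeasure M A = emeasure N A"
    by (simp add: M.emeasure_eq_measure N.emeasure_eq_measure)
qed

text \<open>
  A single uniform variable carries out all the acceptances: the unit interval is cut into consecutive
  intervals whose lengths are the probabilities of accepting \<open>V 0, V 1, \<dots>\<close>, and the choice is the interval
  into which the variable falls. The choice depends on the uniform variable and the values of the
  offers alone, so it is unaffected by any further randomness that does not enter the offers.
\<close>

lemma random_choice:
  fixes Q :: "'q measure" and T :: "'t measure" and V :: "nat \<Rightarrow> 'q \<Rightarrow> 't"
  assumes Q: "prob_space Q" and \<tau>: "prob_space \<tau>" and sets_\<tau>: "sets \<tau> = sets T"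
    and V[measurable]: "\<And>k. V k \<in> Q \<rightarrow>\<^sub>M T"
    and hit: "\<And>D. D \<in> sets T \<Longrightarrow> \<exists>C\<in>sets T. emeasure \<tau> (D - C) = 0 \<and>
      emeasure \<tau> C = emeasure Q {q\<in>space Q. V 0 q \<in> C} \<and>
      (AE q in Q. (\<forall>k. V k q \<in> C \<longleftrightarrow> V 0 q \<in> C) \<and> (V 0 q \<in> C \<longrightarrow> (\<exists>k. V k q \<in> D)))"
  obtains K :: "(nat \<Rightarrow> 't) \<Rightarrow> real \<Rightarrow> nat"
  where "(\<lambda>(q, v). K (\<lambda>k. V k q) v) \<in> Q \<Otimes>\<^sub>M unif \<rightarrow>\<^sub>M count_space UNIV"
    "distr (Q \<Otimes>\<^sub>M unif) T (\<lambda>(q, v). V (K (\<lambda>k. V k q) v) q) = \<tau>"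
proof -
  interpret Q: prob_space Q by fact
  interpret \<tau>: prob_space \<tau> by fact
  interpret QU: pair_prob_space Q unif ..
  obtain p where p[measurable]: "\<And>k. p k \<in> borel_measurable T" and p1: "\<And>k x. p k x \<le> 1"
    and p_sum: "\<And>B. B \<in> sets T \<Longrightarrow> emeasure \<tau> B =
       (\<Sum>k. \<integral>\<^sup>+q. (\<Prod>j<k. 1 - p j (V j q)) * p k (V k q) * indicator B (V k q) \<partial>Q)"
    using greedy_thinning[OF Q \<tau>.finite_measure_axioms sets_\<tau> V hit] by blast
  define r where "r k x = (\<Prod>j<k. 1 - p j (x j))" for k and x :: "nat \<Rightarrow> 't"
  define K where "K x v = (LEAST k. ennreal v < 1 - r (Suc k) x)" for x v
  define x where "x q k = V k q" for q k
  have [measurable]: "(\<lambda>q. r k (x q)) \<in> borel_measurable Q" for k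
    unfolding r_def x_def by measurable
  have K[measurable]: "(\<lambda>(q, v). K (x q) v) \<in> Q \<Otimes>\<^sub>M unif \<rightarrow>\<^sub>M count_space UNIV"
    unfolding K_def by measurable
  have r_Suc: "r (Suc k) y = r k y * (1 - p k (y k))" for k y
    by (simp add: r_def)
  have r_le1: "r k y \<le> 1" for k y
    unfolding r_def by (intro prod_le_1) auto
  have r_split: "r k y = r (Suc k) y + r k y * p k (y k)" for k y
    using p1[of k "y k"] by (simp add: r_Suc distrib_left[symmetric] diff_add_cancel_ennreal)
  have r_anti: "r k y \<le> r j y" if "j \<le> k" for j k y
    using that
  proof (induction rule: dec_induct)
    case (step k)
    have "r (Suc k) y \<le> r k y" by (subst (2) r_split) simp
    then show ?case using step.IH by (rule order_trans)
  qed simp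
  have gap: "(1 - r (Suc k) y) - (1 - r k y) = r k y * p k (y k)" for k y
  proof -
    have fin: "r (Suc k) y \<noteq> \<top>" "1 - r k y \<noteq> \<top>"
      using r_le1[of "Suc k" y] by (auto simp: top_unique)
    have "(1 - r k y) + r k y * p k (y k) + r (Suc k) y = (1 - r k y) + r k y"
      by (subst (3) r_split) (simp add: ac_simps)
    also have "\<dots> = 1" using r_le1 by (rule diff_add_cancel_ennreal)
    finally have "1 - r (Suc k) y = (1 - r k y) + r k y * p k (y k)"
      using fin(1) by (metis ennreal_add_diff_cancel_right infinity_ennreal_def)
    then show ?thesis using fin(2) by simp
  qed
  define I where "I k y = {v::real. 1 - r k y \<le> ennreal v \<and> ennreal v < 1 - r (Suc k) y}" for k y
  have K_I: "K y v = k" if "v \<in> I k y" for k y v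
    unfolding K_def
  proof (rule Least_equality)
    show "ennreal v < 1 - r (Suc k) y" using that by (simp add: I_def)
    fix j assume "ennreal v < 1 - r (Suc j) y"
    show "k \<le> j"
    proof (rule ccontr)
      assume "\<not> k \<le> j"
      then have "1 - r (Suc j) y \<le> 1 - r k y"
        by (intro ennreal_minus_mono r_anti) auto
      also have "\<dots> \<le> ennreal v" using that by (simp add: I_def)
      finally show False using \<open>ennreal v < 1 - r (Suc j) y\<close> by simp
    qed
  qed
  have unif_I: "emeasure unif (I k y) = r k y * p k (y k)" for k y
    unfolding I_def gap[symmetric]
    by (intro emeasure_unif_interval ennreal_minus_mono r_anti) auto
  define sel where "sel = (\<lambda>(q, v). x q (K (x q) v))"
  have sel[measurable]: "sel \<in> Q \<Otimes>\<^sub>M unif \<rightarrow>\<^sub>M T"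
  proof -
    have "(\<lambda>w. V (K (x (fst w)) (snd w)) (fst w)) \<in> Q \<Otimes>\<^sub>M unif \<rightarrow>\<^sub>M T"
    proof (rule measurable_compose_countable[where f="\<lambda>k w. V k (fst w)"])
      show "(\<lambda>w. V k (fst w)) \<in> Q \<Otimes>\<^sub>M unif \<rightarrow>\<^sub>M T" for k by measurable
      show "(\<lambda>w. K (x (fst w)) (snd w)) \<in> Q \<Otimes>\<^sub>M unif \<rightarrow>\<^sub>M count_space UNIV"
        using K by (simp only: case_prod_unfold)
    qed
    then show ?thesis by (simp add: sel_def x_def case_prod_unfold)
  qed
  \<comment> \<open>Both sides are probability measures, so it suffices to bound \<open>\<tau>\<close> from above.\<close>
  have "\<tau> = distr (Q \<Otimes>\<^sub>M unif) T sel"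
  proof (rule prob_measure_eqI_le[OF \<tau>])
    show "prob_space (distr (Q \<Otimes>\<^sub>M unif) T sel)"
      by (rule QU.P.prob_space_distr) simp
    fix B assume "B \<in> sets \<tau>"
    then have B[measurable]: "B \<in> sets T" by (simp add: sets_\<tau>)
    define A where "A k = {w\<in>space (Q \<Otimes>\<^sub>M unif). snd w \<in> I k (x (fst w)) \<and> V k (fst w) \<in> B}" for k
    have A[measurable]: "A k \<in> sets (Q \<Otimes>\<^sub>M unif)" for k
      unfolding A_def I_def by measurable
    have "emeasure \<tau> B = (\<Sum>k. emeasure (Q \<Otimes>\<^sub>M unif) (A k))"
    proof -
      have "emeasure (Q \<Otimes>\<^sub>M unif) (A k) =
          (\<integral>\<^sup>+q. (\<Prod>j<k. 1 - p j (V j q)) * p k (V k q) * indicator B (V k q) \<partial>Q)" for k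
      proof -
        have "emeasure (Q \<Otimes>\<^sub>M unif) (A k) = (\<integral>\<^sup>+q. emeasure unif (Pair q -` A k) \<partial>Q)"
          by (intro unif.emeasure_pair_measure_alt A)
        also have "\<dots> = (\<integral>\<^sup>+q. r k (x q) * p k (V k q) * indicator B (V k q) \<partial>Q)"
        proof (rule nn_integral_cong)
          fix q assume "q \<in> space Q"
          then have "Pair q -` A k = (if V k q \<in> B then I k (x q) else {})"
            by (auto simp: A_def space_pair_measure)
          then show "emeasure unif (Pair q -` A k) = r k (x q) * p k (V k q) * indicator B (V k q)"
            using unif_I[of k "x q"] by (simp add: x_def)
        qed
        finally show ?thesis by (simp add: r_def x_def)
      qed
      then show ?thesis by (simp add: p_sum)
    qed
    also have "\<dots> = emeasure (Q \<Otimes>\<^sub>M unif) (\<Union>k. A k)"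
    proof (rule suminf_emeasure)
      show "range A \<subseteq> sets (Q \<Otimes>\<^sub>M unif)" using A by blast
      show "disjoint_family A" by (auto simp: disjoint_family_on_def A_def dest!: K_I)
    qed
    also have "\<dots> \<le> emeasure (Q \<Otimes>\<^sub>M unif) (sel -` B \<inter> space (Q \<Otimes>\<^sub>M unif))"
      using measurable_sets[OF sel B]
      by (intro emeasure_mono) (auto simp: A_def sel_def x_def dest!: K_I)
    finally show "emeasure \<tau> B \<le> emeasure (distr (Q \<Otimes>\<^sub>M unif) T sel) B"
      by (simp add: emeasure_distr)
  qed (simp add: sets_\<tau>)
  then show ?thesis
    using K by (intro that[of K]) (simp_all add: sel_def x_def[abs_def])
qed

abbreviation noise :: "(nat \<Rightarrow> real) measure" where
  "noise \<equiv> \<Pi>\<^sub>M n\<in>UNIV. unif"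

interpretation noise: product_prob_space "\<lambda>_::nat. unif" UNIV ..

lemma distr_noise_upd: "distr (noise \<Otimes>\<^sub>M unif) noise (\<lambda>(u, v). u(n := v)) = noise"
proof (rule measure_eqI_PiM_infinite[symmetric])
  interpret NU: pair_prob_space noise unif ..
  have upd[measurable]: "(\<lambda>(u, v). u(n := v)) \<in> noise \<Otimes>\<^sub>M unif \<rightarrow>\<^sub>M noise"
    unfolding case_prod_unfold by (rule measurable_fun_upd[where J=UNIV]) auto
  fix A :: "nat \<Rightarrow> real set" and J :: "nat set"
  assume J: "finite J" "J \<subseteq> UNIV" and A: "\<And>i. i \<in> J \<Longrightarrow> A i \<in> sets unif"
  let ?E = "\<lambda>J. prod_emb UNIV (\<lambda>_. unif) J (Pi\<^sub>E J A)"
  let ?B = "if n \<in> J then A n else UNIV"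
  have B: "?B \<in> sets unif" using A by auto
  have E: "?E J = {u. \<forall>i\<in>J. u i \<in> A i}" for J
    by (auto simp: prod_emb_def PiE_iff)
  have E_sets: "?E J \<in> sets noise" "?E (J - {n}) \<in> sets noise"
    using J A by (auto intro!: sets_PiM_I)
  have "(\<lambda>(u, v). u(n := v)) -` ?E J \<inter> space (noise \<Otimes>\<^sub>M unif) = ?E (J - {n}) \<times> ?B"
    unfolding E by (auto simp: space_pair_measure space_PiM split: if_splits)
  then have "emeasure (distr (noise \<Otimes>\<^sub>M unif) noise (\<lambda>(u, v). u(n := v))) (?E J) =
      emeasure (noise \<Otimes>\<^sub>M unif) (?E (J - {n}) \<times> ?B)"
    using E_sets by (subst emeasure_distr[OF upd]) auto
  also have "\<dots> = emeasure noise (?E (J - {n})) * emeasure unif ?B"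
    by (rule unif.emeasure_pair_measure_Times[OF E_sets(2) B])
  also have "\<dots> = emeasure noise (?E J)"
  proof -
    have "emeasure noise (?E J') = (\<Prod>i\<in>J'. emeasure unif (A i))" if "J' \<subseteq> J" for J'
      using that finite_subset[OF that J(1)] A by (intro noise.emeasure_PiM_emb) auto
    then show ?thesis
      using J(1) unif.emeasure_space_1 by (auto simp: prod.remove[of J n] mult.commute)
  qed
  finally show "emeasure noise (?E J) = emeasure (distr (noise \<Otimes>\<^sub>M unif) noise (\<lambda>(u, v). u(n := v))) (?E J)"
    by simp
qed (auto intro: noise.finite_measure_axioms)

definition resample :: "nat \<Rightarrow> ('a \<times> (nat \<Rightarrow> real)) \<times> real \<Rightarrow> 'a \<times> (nat \<Rightarrow> real)" where
  "resample n w = (fst (fst w), (snd (fst w))(n := snd w))"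

lemma measurable_resample[measurable]:
  "resample n \<in> (M \<Otimes>\<^sub>M noise) \<Otimes>\<^sub>M unif \<rightarrow>\<^sub>M M \<Otimes>\<^sub>M noise"
proof -
  have "(\<lambda>w. (snd (fst w))(n := snd w)) \<in> (M \<Otimes>\<^sub>M noise) \<Otimes>\<^sub>M unif \<rightarrow>\<^sub>M noise"
    by (rule measurable_fun_upd[where J=UNIV]) auto
  then show ?thesis unfolding resample_def[abs_def] by measurable
qed

text \<open>
  Replacing one coordinate of the noise by a fresh uniform variable preserves the product measure. This is
  how the coordinate \<open>n\<close> serves as the fresh variable for a choice among objects that do not depend on it.
\<close>

lemma distr_resample:
  assumes "prob_space M"
  shows "distr ((M \<Otimes>\<^sub>M noise) \<Otimes>\<^sub>M unif) (M \<Otimes>\<^sub>M noise) (resample n) = M \<Otimes>\<^sub>M noise"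
proof (rule pair_measure_eqI[symmetric])
  interpret M: prob_space M by fact
  show "sigma_finite_measure M" "sigma_finite_measure noise"
    by (rule M.sigma_finite_measure_axioms noise.sigma_finite_measure_axioms)+
  have upd[measurable]: "(\<lambda>(u, v). u(n := v)) \<in> noise \<Otimes>\<^sub>M unif \<rightarrow>\<^sub>M noise"
    unfolding case_prod_unfold by (rule measurable_fun_upd[where J=UNIV]) auto
  fix A B assume A[measurable]: "A \<in> sets M" and B[measurable]: "B \<in> sets noise"
  define G where "G u = emeasure unif {v. u(n := v) \<in> B}" for u
  have B': "{w\<in>space (noise \<Otimes>\<^sub>M unif). (fst w)(n := snd w) \<in> B} \<in> sets (noise \<Otimes>\<^sub>M unif)"
    using measurable_sets[OF upd B] by (auto simp: vimage_def Int_def case_prod_unfold conj_commute)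
  have G_eq: "G u = emeasure unif (Pair u -` {w\<in>space (noise \<Otimes>\<^sub>M unif). (fst w)(n := snd w) \<in> B})" for u
    by (auto simp: G_def space_pair_measure space_PiM vimage_def intro!: arg_cong[where f="emeasure unif"])
  have G[measurable]: "G \<in> borel_measurable noise"
    unfolding G_eq using B' by (rule unif.measurable_emeasure_Pair)
  have "emeasure noise B = emeasure (distr (noise \<Otimes>\<^sub>M unif) noise (\<lambda>(u, v). u(n := v))) B"
    by (simp only: distr_noise_upd)
  also have "\<dots> = emeasure (noise \<Otimes>\<^sub>M unif) {w\<in>space (noise \<Otimes>\<^sub>M unif). (fst w)(n := snd w) \<in> B}"
    by (subst emeasure_distr) (auto intro!: arg_cong[where f="emeasure (noise \<Otimes>\<^sub>M unif)"])
  also have "\<dots> = (\<integral>\<^sup>+u. G u \<partial>noise)"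
    unfolding G_eq by (rule unif.emeasure_pair_measure_alt[OF B'])
  finally have noise_B: "emeasure noise B = (\<integral>\<^sup>+u. G u \<partial>noise)" .
  let ?Q = "M \<Otimes>\<^sub>M noise"
  have "emeasure (distr (?Q \<Otimes>\<^sub>M unif) ?Q (resample n)) (A \<times> B) =
      emeasure (?Q \<Otimes>\<^sub>M unif) (resample n -` (A \<times> B) \<inter> space (?Q \<Otimes>\<^sub>M unif))"
    by (rule emeasure_distr) auto
  also have "\<dots> = (\<integral>\<^sup>+q. emeasure unif (Pair q -` (resample n -` (A \<times> B) \<inter> space (?Q \<Otimes>\<^sub>M unif))) \<partial>?Q)"
    by (intro unif.emeasure_pair_measure_alt measurable_sets[OF measurable_resample]) auto
  also have "\<dots> = (\<integral>\<^sup>+q. indicator A (fst q) * G (snd q) \<partial>?Q)"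
  proof (rule nn_integral_cong)
    fix q assume "q \<in> space ?Q"
    then have "Pair q -` (resample n -` (A \<times> B) \<inter> space (?Q \<Otimes>\<^sub>M unif)) =
        (if fst q \<in> A then {v. (snd q)(n := v) \<in> B} else {})"
      by (auto simp: resample_def space_pair_measure)
    then show "emeasure unif (Pair q -` (resample n -` (A \<times> B) \<inter> space (?Q \<Otimes>\<^sub>M unif))) =
        indicator A (fst q) * G (snd q)"
      by (simp add: G_def)
  qed
  also have "\<dots> = (\<integral>\<^sup>+a. \<integral>\<^sup>+u. indicator A a * G u \<partial>noise \<partial>M)"
    by (subst noise.nn_integral_fst[symmetric]) auto
  also have "\<dots> = emeasure M A * emeasure noise B"
    by (simp add: nn_integral_cmult nn_integral_multc noise_B)
  finally show "emeasure M A * emeasure noise B =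
      emeasure (distr (?Q \<Otimes>\<^sub>M unif) ?Q (resample n)) (A \<times> B)" by simp
qed simp

lemma random_choice_from_noise:
  fixes M :: "'a measure" and T :: "'t measure" and V :: "nat \<Rightarrow> 'a \<times> (nat \<Rightarrow> real) \<Rightarrow> 't"
  assumes M: "prob_space M" and \<tau>: "prob_space \<tau>" and sets_\<tau>: "sets \<tau> = sets T"
    and V[measurable]: "\<And>k. V k \<in> M \<Otimes>\<^sub>M noise \<rightarrow>\<^sub>M T"
    and V_indep: "\<And>k m \<omega> u v. n \<le> m \<Longrightarrow> V k (\<omega>, u(m := v)) = V k (\<omega>, u)"
    and hit: "\<And>D. D \<in> sets T \<Longrightarrow> \<exists>C\<in>sets T. emeasure \<tau> (D - C) = 0 \<and>
      emeasure \<tau> C = emeasure (M \<Otimes>\<^sub>M noise) {q\<in>space (M \<Otimes>\<^sub>M noise). V 0 q \<in> C} \<and>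
      (AE q in M \<Otimes>\<^sub>M noise. (\<forall>k. V k q \<in> C \<longleftrightarrow> V 0 q \<in> C) \<and> (V 0 q \<in> C \<longrightarrow> (\<exists>k. V k q \<in> D)))"
  obtains \<kappa> where "\<kappa> \<in> M \<Otimes>\<^sub>M noise \<rightarrow>\<^sub>M count_space UNIV"
    "distr (M \<Otimes>\<^sub>M noise) T (\<lambda>q. V (\<kappa> q) q) = \<tau>"
    "\<And>m \<omega> u v. n < m \<Longrightarrow> \<kappa> (\<omega>, u(m := v)) = \<kappa> (\<omega>, u)"
proof -
  interpret M: prob_space M by fact
  interpret MN: pair_prob_space M noise ..
  let ?Q = "M \<Otimes>\<^sub>M noise"
  obtain K where K: "(\<lambda>(q, v). K (\<lambda>k. V k q) v) \<in> ?Q \<Otimes>\<^sub>M unif \<rightarrow>\<^sub>M count_space UNIV"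
    and K_distr: "distr (?Q \<Otimes>\<^sub>M unif) T (\<lambda>(q, v). V (K (\<lambda>k. V k q) v) q) = \<tau>"
    using random_choice[OF MN.P.prob_space_axioms \<tau> sets_\<tau> V hit] by blast
  define \<kappa> where "\<kappa> q = K (\<lambda>k. V k q) (snd q n)" for q
  have coord: "(\<lambda>q. (q, snd q n)) \<in> ?Q \<rightarrow>\<^sub>M ?Q \<Otimes>\<^sub>M unif"
    by measurable
  have \<kappa>[measurable]: "\<kappa> \<in> ?Q \<rightarrow>\<^sub>M count_space UNIV"
    using measurable_compose[OF coord K] by (simp add: \<kappa>_def[abs_def])
  have sel: "(\<lambda>q. V (\<kappa> q) q) \<in> ?Q \<rightarrow>\<^sub>M T"
    by (rule measurable_compose_countable[OF V \<kappa>])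
  show thesis
  proof (rule that[OF \<kappa>])
    have "distr ?Q T (\<lambda>q. V (\<kappa> q) q) = distr (distr (?Q \<Otimes>\<^sub>M unif) ?Q (resample n)) T (\<lambda>q. V (\<kappa> q) q)"
      by (simp only: distr_resample[OF M])
    also have "\<dots> = distr (?Q \<Otimes>\<^sub>M unif) T (\<lambda>w. V (\<kappa> (resample n w)) (resample n w))"
      using distr_distr[OF sel measurable_resample] by (simp add: comp_def)
    also have "(\<lambda>w. V (\<kappa> (resample n w)) (resample n w)) = (\<lambda>(q, v). V (K (\<lambda>k. V k q) v) q)"
      by (auto simp: fun_eq_iff resample_def \<kappa>_def V_indep)
    finally show "distr ?Q T (\<lambda>q. V (\<kappa> q) q) = \<tau>" using K_distr by simp
  next
    fix m \<omega> u v assume "n < m"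
    then show "\<kappa> (\<omega>, u(m := v)) = \<kappa> (\<omega>, u)"
      by (simp add: \<kappa>_def V_indep)
  qed
qed

section \<open>Back and forth between two random sets\<close>

text \<open>
  A random tuple of \<open>n\<close> points of the enumerated set, constructed from the first \<open>n\<close> coordinates of the
  noise.
\<close>

definition partial_enumeration ::
  "'a measure \<Rightarrow> ('a \<Rightarrow> nat \<Rightarrow> real) \<Rightarrow> nat \<Rightarrow> ('a \<times> (nat \<Rightarrow> real) \<Rightarrow> nat \<Rightarrow> real) \<Rightarrow> bool" where
  "partial_enumeration M Y n \<zeta> \<longleftrightarrow>
     \<zeta> \<in> M \<Otimes>\<^sub>M noise \<rightarrow>\<^sub>M real_seqs \<and>
     (\<forall>q. (\<forall>i<n. \<zeta> q i \<in> range (Y (fst q))) \<and> (\<forall>i\<ge>n. \<zeta> q i = 0)) \<and>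
     (\<forall>\<omega> u m v. n \<le> m \<longrightarrow> \<zeta> (\<omega>, u(m := v)) = \<zeta> (\<omega>, u))"

lemma measurable_seq_upd[measurable]:
  assumes "f \<in> N \<rightarrow>\<^sub>M real_seqs" "g \<in> borel_measurable N"
  shows "(\<lambda>q. (f q)(n := g q)) \<in> N \<rightarrow>\<^sub>M real_seqs"
  by (rule measurable_fun_upd[where J=UNIV]) (use assms in auto)

lemma partial_enumeration_extend:
  fixes Y :: "'a \<Rightarrow> nat \<Rightarrow> real"
  assumes \<zeta>: "partial_enumeration M Y n \<zeta>"
    and Y: "Y \<in> M \<rightarrow>\<^sub>M real_seqs"
    and \<kappa>: "\<kappa> \<in> M \<Otimes>\<^sub>M noise \<rightarrow>\<^sub>M count_space UNIV"
    and \<kappa>_indep: "\<And>m \<omega> u v. n < m \<Longrightarrow> \<kappa> (\<omega>, u(m := v)) = \<kappa> (\<omega>, u)"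
  shows "partial_enumeration M Y (Suc n) (\<lambda>q. (\<zeta> q)(n := Y (fst q) (\<kappa> q)))"
proof -
  have Yk: "(\<lambda>q. Y (fst q) k) \<in> borel_measurable (M \<Otimes>\<^sub>M noise)" for k
    using Y by measurable
  have meas: "(\<lambda>q. Y (fst q) (\<kappa> q)) \<in> borel_measurable (M \<Otimes>\<^sub>M noise)"
    by (rule measurable_compose_countable[OF Yk \<kappa>])
  have "\<zeta> \<in> M \<Otimes>\<^sub>M noise \<rightarrow>\<^sub>M real_seqs"
    using \<zeta> by (simp add: partial_enumeration_def)
  then have "(\<lambda>q. (\<zeta> q)(n := Y (fst q) (\<kappa> q))) \<in> M \<Otimes>\<^sub>M noise \<rightarrow>\<^sub>M real_seqs"
    using meas by (rule measurable_seq_upd)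
  then show ?thesis
    using \<zeta> \<kappa>_indep by (auto simp: partial_enumeration_def less_Suc_eq)
qed

lemma AE_pair_fst:
  assumes "prob_space N" "AE x in M. P x"
  shows "AE q in M \<Otimes>\<^sub>M N. P (fst q)"
proof -
  interpret N: prob_space N by fact
  have "AE x in distr (M \<Otimes>\<^sub>M N) M fst. P x"
    unfolding N.distr_pair_fst by (rule assms(2))
  then show ?thesis by (rule AE_distrD[rotated]) simp
qed

lemma partial_enumeration_dichotomy:
  assumes \<zeta>: "partial_enumeration M Y n \<zeta>" and "hit_dichotomy M Y n D"
  shows "AE q in M \<Otimes>\<^sub>M noise.
    (\<exists>x\<in>range (Y (fst q)) - \<zeta> q ` {..<n}. (\<zeta> q, x) \<in> D) \<longleftrightarrow>
    emeasure lborel {x\<in>{0<..<1}. (\<zeta> q, x) \<in> D} \<noteq> 0"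
proof -
  have "AE q in M \<Otimes>\<^sub>M noise. \<forall>z. (\<forall>i<n. z i \<in> range (Y (fst q))) \<and> (\<forall>i\<ge>n. z i = 0) \<longrightarrow>
        ((\<exists>x\<in>range (Y (fst q)) - z ` {..<n}. (z, x) \<in> D) \<longleftrightarrow>
         emeasure lborel {x\<in>{0<..<1}. (z, x) \<in> D} \<noteq> 0)"
    using assms(2) unfolding hit_dichotomy_def
    by (intro AE_pair_fst noise.prob_space_axioms)
  then show ?thesis
  proof eventually_elim
    case (elim q)
    have "(\<forall>i<n. \<zeta> q i \<in> range (Y (fst q))) \<and> (\<forall>i\<ge>n. \<zeta> q i = 0)"
      using \<zeta> unfolding partial_enumeration_def by blast
    then show ?case by (rule elim[THEN spec, THEN mp])
  qed
qed

text \<open>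
  The active side of a step takes the point \<open>Y j\<close>, or the first point not yet used if \<open>Y j\<close> was used before.
\<close>

lemma choose_next_point:
  fixes Y :: "'a \<Rightarrow> nat \<Rightarrow> real"
  assumes \<zeta>: "partial_enumeration M Y n \<zeta>" and Y[measurable]: "Y \<in> M \<rightarrow>\<^sub>M real_seqs"
    and inj: "\<And>\<omega>. \<omega> \<in> space M \<Longrightarrow> inj (Y \<omega>)"
  obtains \<zeta>' where "partial_enumeration M Y (Suc n) \<zeta>'" "\<And>q i. i \<noteq> n \<Longrightarrow> \<zeta>' q i = \<zeta> q i"
    "\<And>q. q \<in> space (M \<Otimes>\<^sub>M noise) \<Longrightarrow> \<zeta>' q n \<in> range (Y (fst q)) - \<zeta> q ` {..<n}"
    "\<And>q. q \<in> space (M \<Otimes>\<^sub>M noise) \<Longrightarrow> Y (fst q) j \<in> \<zeta>' q ` {..n}"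
proof -
  have \<zeta>_meas[measurable]: "\<zeta> \<in> M \<Otimes>\<^sub>M noise \<rightarrow>\<^sub>M real_seqs"
    and \<zeta>_indep: "\<And>\<omega> u m v. n \<le> m \<Longrightarrow> \<zeta> (\<omega>, u(m := v)) = \<zeta> (\<omega>, u)"
    using \<zeta> by (auto simp: partial_enumeration_def)
  define new where "new k q \<longleftrightarrow> (\<forall>i<n. Y (fst q) k \<noteq> \<zeta> q i)" for k q
  have [measurable]: "Measurable.pred (M \<Otimes>\<^sub>M noise) (new k)" for k
    unfolding new_def[abs_def] by measurable
  define \<kappa> where "\<kappa> q = (if new j q then j else (LEAST k. new k q))" for q
  have \<kappa>: "\<kappa> \<in> M \<Otimes>\<^sub>M noise \<rightarrow>\<^sub>M count_space UNIV"
    unfolding \<kappa>_def by measurable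
  have \<kappa>_indep: "\<kappa> (\<omega>, u(m := v)) = \<kappa> (\<omega>, u)" if "n < m" for m \<omega> u v
  proof -
    have "new k (\<omega>, u(m := v)) = new k (\<omega>, u)" for k
      using that by (simp add: new_def \<zeta>_indep)
    then show ?thesis by (simp add: \<kappa>_def)
  qed
  have new_\<kappa>: "new (\<kappa> q) q" if "q \<in> space (M \<Otimes>\<^sub>M noise)" for q
  proof -
    have "infinite (range (Y (fst q)))"
      using inj[of "fst q"] that by (intro range_inj_infinite) (auto simp: space_pair_measure)
    then have "\<not> range (Y (fst q)) \<subseteq> \<zeta> q ` {..<n}"
      using finite_subset by blast
    then obtain k where "new k q" by (auto simp: new_def)
    then show ?thesis by (auto simp: \<kappa>_def intro: LeastI)
  qed
  show thesis
  proof (rule that[OF partial_enumeration_extend[OF \<zeta> Y \<kappa> \<kappa>_indep]])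
    fix q assume q: "q \<in> space (M \<Otimes>\<^sub>M noise)"
    show "((\<zeta> q)(n := Y (fst q) (\<kappa> q))) n \<in> range (Y (fst q)) - \<zeta> q ` {..<n}"
      using new_\<kappa>[OF q] by (auto simp: new_def)
    show "Y (fst q) j \<in> (\<zeta> q)(n := Y (fst q) (\<kappa> q)) ` {..n}"
    proof (cases "new j q")
      case True
      then show ?thesis by (intro image_eqI[of _ _ n]) (auto simp: \<kappa>_def)
    next
      case False
      then obtain i where "i < n" "Y (fst q) j = \<zeta> q i" by (auto simp: new_def)
      then show ?thesis by (intro image_eqI[of _ _ i]) auto
    qed
  qed auto
qed

text \<open>
  The passive side of a step: its new point has the joint distribution \<open>\<tau>\<close> with the previous ones. The
  dichotomy supplies the hypothesis of the greedy selection, with \<open>C\<close> the set of tuples for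
  which the section of \<open>D\<close> has positive measure.
\<close>

lemma match_next_point:
  fixes Y :: "'a \<Rightarrow> nat \<Rightarrow> real"
  assumes M: "prob_space M" and \<zeta>: "partial_enumeration M Y n \<zeta>" and Y[measurable]: "Y \<in> M \<rightarrow>\<^sub>M real_seqs"
    and dich: "\<And>D. D \<in> sets (real_seqs \<Otimes>\<^sub>M borel) \<Longrightarrow> hit_dichotomy M Y n D"
    and \<tau>: "prob_space \<tau>" "sets \<tau> = sets (real_seqs \<Otimes>\<^sub>M borel)"
    and marginal: "distr \<tau> real_seqs fst = distr (M \<Otimes>\<^sub>M noise) real_seqs \<zeta>"
    and ac: "\<And>D. D \<in> sets (real_seqs \<Otimes>\<^sub>M borel) \<Longrightarrow>
      (\<And>z. emeasure lborel {x\<in>{0<..<1}. (z, x) \<in> D} = 0) \<Longrightarrow> emeasure \<tau> D = 0"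
  obtains \<zeta>' where "partial_enumeration M Y (Suc n) \<zeta>'" "\<And>q i. i \<noteq> n \<Longrightarrow> \<zeta>' q i = \<zeta> q i"
    "distr (M \<Otimes>\<^sub>M noise) (real_seqs \<Otimes>\<^sub>M borel) (\<lambda>q. (\<zeta> q, \<zeta>' q n)) = \<tau>"
proof -
  let ?Q = "M \<Otimes>\<^sub>M noise" and ?T = "real_seqs \<Otimes>\<^sub>M (borel :: real measure)"
  have \<zeta>_meas[measurable]: "\<zeta> \<in> ?Q \<rightarrow>\<^sub>M real_seqs"
    and \<zeta>_indep: "\<And>\<omega> u m v. n \<le> m \<Longrightarrow> \<zeta> (\<omega>, u(m := v)) = \<zeta> (\<omega>, u)"
    using \<zeta> by (auto simp: partial_enumeration_def)
  define V where "V k q = (\<zeta> q, Y (fst q) k)" for k q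
  have V: "V k \<in> ?Q \<rightarrow>\<^sub>M ?T" for k
    unfolding V_def by measurable
  obtain \<kappa> where \<kappa>: "\<kappa> \<in> ?Q \<rightarrow>\<^sub>M count_space UNIV"
    and \<kappa>_distr: "distr ?Q ?T (\<lambda>q. V (\<kappa> q) q) = \<tau>"
    and \<kappa>_indep: "\<And>m \<omega> u v. n < m \<Longrightarrow> \<kappa> (\<omega>, u(m := v)) = \<kappa> (\<omega>, u)"
  proof (rule random_choice_from_noise[OF M \<tau> V, where n=n])
    show "V k (\<omega>, u(m := v)) = V k (\<omega>, u)" if "n \<le> m" for k m \<omega> u v
      using that by (simp add: V_def \<zeta>_indep)
    fix D assume D[measurable]: "D \<in> sets ?T"
    define F where "F z = emeasure lborel {x\<in>{0<..<1}. (z, x) \<in> D}" for z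
    have [measurable]: "F \<in> borel_measurable real_seqs"
    proof -
      have "{v\<in>space ?T. 0 < snd v \<and> snd v < 1 \<and> v \<in> D} \<in> sets ?T" by measurable
      then have "(\<lambda>z. emeasure lborel {x\<in>space lborel. x \<in> {0<..<1} \<and> (z, x) \<in> D}) \<in> borel_measurable real_seqs"
        by (intro lborel.measurable_emeasure) (auto simp: space_pair_measure)
      then show ?thesis by (simp add: F_def[abs_def])
    qed
    define C' where "C' = {z\<in>space real_seqs. F z \<noteq> 0}"
    have C'[measurable]: "C' \<in> sets real_seqs" unfolding C'_def by measurable
    define C where "C = C' \<times> (UNIV :: real set)"
    have C[measurable]: "C \<in> sets ?T" unfolding C_def by (intro pair_measureI) auto
    have "emeasure \<tau> (D - C) = 0"
    proof (rule ac)
      fix z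
      have "{x\<in>{0<..<1}. (z, x) \<in> D - C} = (if F z = 0 then {x\<in>{0<..<1}. (z, x) \<in> D} else {})"
        by (auto simp: C_def C'_def space_PiM)
      then show "emeasure lborel {x\<in>{0<..<1}. (z, x) \<in> D - C} = 0"
        by (simp add: F_def)
    qed measurable
    moreover have "emeasure \<tau> C = emeasure ?Q {q\<in>space ?Q. V 0 q \<in> C}"
    proof -
      have [simp]: "space \<tau> = space ?T" by (rule sets_eq_imp_space_eq) fact
      have [measurable]: "fst \<in> \<tau> \<rightarrow>\<^sub>M real_seqs"
        using measurable_fst[of real_seqs "borel :: real measure"] \<tau>(2) by (simp cong: measurable_cong_sets)
      have "emeasure \<tau> C = emeasure (distr \<tau> real_seqs fst) C'"
        by (subst emeasure_distr) (auto simp: C_def space_pair_measure space_PiM intro!: arg_cong[where f="emeasure \<tau>"])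
      also have "\<dots> = emeasure ?Q {q\<in>space ?Q. V 0 q \<in> C}"
        unfolding marginal
        by (subst emeasure_distr) (auto simp: C_def V_def intro!: arg_cong[where f="emeasure ?Q"])
      finally show ?thesis .
    qed
    moreover have "AE q in ?Q. (\<forall>k. V k q \<in> C \<longleftrightarrow> V 0 q \<in> C) \<and> (V 0 q \<in> C \<longrightarrow> (\<exists>k. V k q \<in> D))"
      using partial_enumeration_dichotomy[OF \<zeta> dich[OF D]]
    proof eventually_elim
      case (elim q)
      then show ?case
        by (auto simp: V_def C_def C'_def F_def)
    qed
    ultimately show "\<exists>C\<in>sets ?T. emeasure \<tau> (D - C) = 0 \<and>
      emeasure \<tau> C = emeasure ?Q {q\<in>space ?Q. V 0 q \<in> C} \<and>
      (AE q in ?Q. (\<forall>k. V k q \<in> C \<longleftrightarrow> V 0 q \<in> C) \<and> (V 0 q \<in> C \<longrightarrow> (\<exists>k. V k q \<in> D)))"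
      using C by blast
  qed blast
  show thesis
    by (rule that[OF partial_enumeration_extend[OF \<zeta> Y \<kappa> \<kappa>_indep]])
       (use \<kappa>_distr in \<open>auto simp: V_def\<close>)
qed

text \<open>
  The distribution of the new point of the active side is a legitimate target for the passive side because
  the dichotomy on the active side makes it absolutely continuous.
\<close>

lemma back_and_forth_step:
  fixes Ya :: "'a \<Rightarrow> nat \<Rightarrow> real" and Yb :: "'b \<Rightarrow> nat \<Rightarrow> real"
  assumes A: "prob_space A" "Ya \<in> A \<rightarrow>\<^sub>M real_seqs" "\<And>\<omega>. \<omega> \<in> space A \<Longrightarrow> inj (Ya \<omega>)"
    and dich_a: "\<And>D. D \<in> sets (real_seqs \<Otimes>\<^sub>M borel) \<Longrightarrow> hit_dichotomy A Ya n D"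
    and B: "prob_space B" "Yb \<in> B \<rightarrow>\<^sub>M real_seqs"
    and dich_b: "\<And>D. D \<in> sets (real_seqs \<Otimes>\<^sub>M borel) \<Longrightarrow> hit_dichotomy B Yb n D"
    and \<zeta>a: "partial_enumeration A Ya n \<zeta>a" and \<zeta>b: "partial_enumeration B Yb n \<zeta>b"
    and eq: "distr (A \<Otimes>\<^sub>M noise) real_seqs \<zeta>a = distr (B \<Otimes>\<^sub>M noise) real_seqs \<zeta>b"
  obtains \<zeta>a' \<zeta>b' where "partial_enumeration A Ya (Suc n) \<zeta>a'" "partial_enumeration B Yb (Suc n) \<zeta>b'"
    "distr (A \<Otimes>\<^sub>M noise) real_seqs \<zeta>a' = distr (B \<Otimes>\<^sub>M noise) real_seqs \<zeta>b'"
    "\<And>q i. i \<noteq> n \<Longrightarrow> \<zeta>a' q i = \<zeta>a q i" "\<And>q i. i \<noteq> n \<Longrightarrow> \<zeta>b' q i = \<zeta>b q i"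
    "\<And>q. q \<in> space (A \<Otimes>\<^sub>M noise) \<Longrightarrow> Ya (fst q) j \<in> \<zeta>a' q ` {..n}"
proof -
  let ?T = "real_seqs \<Otimes>\<^sub>M (borel :: real measure)"
  interpret A: prob_space A by fact
  interpret AN: pair_prob_space A noise ..
  obtain \<zeta>a' where \<zeta>a': "partial_enumeration A Ya (Suc n) \<zeta>a'" "\<And>q i. i \<noteq> n \<Longrightarrow> \<zeta>a' q i = \<zeta>a q i"
    and new: "\<And>q. q \<in> space (A \<Otimes>\<^sub>M noise) \<Longrightarrow> \<zeta>a' q n \<in> range (Ya (fst q)) - \<zeta>a q ` {..<n}"
    and j: "\<And>q. q \<in> space (A \<Otimes>\<^sub>M noise) \<Longrightarrow> Ya (fst q) j \<in> \<zeta>a' q ` {..n}"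
    using choose_next_point[OF \<zeta>a A(2,3)] by blast
  have [measurable]: "\<zeta>a \<in> A \<Otimes>\<^sub>M noise \<rightarrow>\<^sub>M real_seqs" "\<zeta>a' \<in> A \<Otimes>\<^sub>M noise \<rightarrow>\<^sub>M real_seqs"
    using \<zeta>a \<zeta>a'(1) by (auto simp: partial_enumeration_def)
  define \<tau> where "\<tau> = distr (A \<Otimes>\<^sub>M noise) ?T (\<lambda>q. (\<zeta>a q, \<zeta>a' q n))"
  have \<tau>: "prob_space \<tau>" unfolding \<tau>_def by (rule AN.P.prob_space_distr) measurable
  have marginal: "distr \<tau> real_seqs fst = distr (B \<Otimes>\<^sub>M noise) real_seqs \<zeta>b"
    unfolding \<tau>_def eq[symmetric] by (subst distr_distr) (auto simp: comp_def)
  have ac: "emeasure \<tau> D = 0"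
    if D[measurable]: "D \<in> sets ?T" and null: "\<And>z. emeasure lborel {x\<in>{0<..<1}. (z, x) \<in> D} = 0" for D
  proof -
    have "AE q in A \<Otimes>\<^sub>M noise. (\<zeta>a q, \<zeta>a' q n) \<notin> D"
      using partial_enumeration_dichotomy[OF \<zeta>a dich_a[OF D]] AE_space
    proof eventually_elim
      case (elim q)
      then show ?case using new[of q] null[of "\<zeta>a q"] by blast
    qed
    then have "emeasure (A \<Otimes>\<^sub>M noise) {q\<in>space (A \<Otimes>\<^sub>M noise). (\<zeta>a q, \<zeta>a' q n) \<in> D} = 0"
      by (subst (asm) AE_iff_measurable[OF _ refl]) auto
    also have "{q\<in>space (A \<Otimes>\<^sub>M noise). (\<zeta>a q, \<zeta>a' q n) \<in> D} =
        (\<lambda>q. (\<zeta>a q, \<zeta>a' q n)) -` D \<inter> space (A \<Otimes>\<^sub>M noise)" by auto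
    finally show ?thesis
      unfolding \<tau>_def by (subst emeasure_distr) auto
  qed
  have sets_\<tau>: "sets \<tau> = sets ?T" by (simp add: \<tau>_def)
  have "\<exists>\<zeta>b'. partial_enumeration B Yb (Suc n) \<zeta>b' \<and> (\<forall>q i. i \<noteq> n \<longrightarrow> \<zeta>b' q i = \<zeta>b q i) \<and>
      distr (B \<Otimes>\<^sub>M noise) ?T (\<lambda>q. (\<zeta>b q, \<zeta>b' q n)) = \<tau>"
    by (rule match_next_point[OF B(1) \<zeta>b B(2) dich_b \<tau> sets_\<tau> marginal ac]) (assumption | blast)+
  then obtain \<zeta>b' where \<zeta>b': "partial_enumeration B Yb (Suc n) \<zeta>b'" "\<And>q i. i \<noteq> n \<Longrightarrow> \<zeta>b' q i = \<zeta>b q i"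
    and \<zeta>b'_distr: "distr (B \<Otimes>\<^sub>M noise) ?T (\<lambda>q. (\<zeta>b q, \<zeta>b' q n)) = \<tau>"
    by blast
  have [measurable]: "\<zeta>b \<in> B \<Otimes>\<^sub>M noise \<rightarrow>\<^sub>M real_seqs" "\<zeta>b' \<in> B \<Otimes>\<^sub>M noise \<rightarrow>\<^sub>M real_seqs"
    using \<zeta>b \<zeta>b'(1) by (auto simp: partial_enumeration_def)
  have upd[measurable]: "(\<lambda>w. (fst w)(n := snd w)) \<in> ?T \<rightarrow>\<^sub>M real_seqs"
    by measurable
  have a: "\<zeta>a' = (\<lambda>q. (\<zeta>a q)(n := \<zeta>a' q n))" and b: "\<zeta>b' = (\<lambda>q. (\<zeta>b q)(n := \<zeta>b' q n))"
    using \<zeta>a'(2) \<zeta>b'(2) by (auto simp: fun_eq_iff)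
  have "distr (A \<Otimes>\<^sub>M noise) real_seqs \<zeta>a' = distr \<tau> real_seqs (\<lambda>w. (fst w)(n := snd w))"
    unfolding \<tau>_def by (subst a, subst distr_distr) (auto simp: comp_def)
  also have "\<dots> = distr (B \<Otimes>\<^sub>M noise) real_seqs \<zeta>b'"
    unfolding \<zeta>b'_distr[symmetric] by (subst (2) b, subst distr_distr) (auto simp: comp_def)
  finally show thesis
    using that \<zeta>a' \<zeta>b' j by blast
qed

text \<open>
  Steps with even number \<open>2 j\<close> use up the \<open>j\<close>-th point of the first enumeration, steps with odd number
  \<open>2 j + 1\<close> that of the second, so both sets are exhausted in the limit.
\<close>

lemma common_random_enumeration:
  fixes Ya :: "'a \<Rightarrow> nat \<Rightarrow> real" and Yb :: "'b \<Rightarrow> nat \<Rightarrow> real"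
  assumes A: "prob_space A" "Ya \<in> A \<rightarrow>\<^sub>M real_seqs" "\<And>\<omega>. \<omega> \<in> space A \<Longrightarrow> inj (Ya \<omega>)"
    and dich_a: "\<And>n D. D \<in> sets (real_seqs \<Otimes>\<^sub>M borel) \<Longrightarrow> hit_dichotomy A Ya n D"
    and B: "prob_space B" "Yb \<in> B \<rightarrow>\<^sub>M real_seqs" "\<And>\<omega>. \<omega> \<in> space B \<Longrightarrow> inj (Yb \<omega>)"
    and dich_b: "\<And>n D. D \<in> sets (real_seqs \<Otimes>\<^sub>M borel) \<Longrightarrow> hit_dichotomy B Yb n D"
  obtains Za Zb where "Za \<in> A \<Otimes>\<^sub>M noise \<rightarrow>\<^sub>M real_seqs" "Zb \<in> B \<Otimes>\<^sub>M noise \<rightarrow>\<^sub>M real_seqs"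
    "distr (A \<Otimes>\<^sub>M noise) real_seqs Za = distr (B \<Otimes>\<^sub>M noise) real_seqs Zb"
    "\<And>q. q \<in> space (A \<Otimes>\<^sub>M noise) \<Longrightarrow> range (Za q) = range (Ya (fst q))"
    "\<And>q. q \<in> space (B \<Otimes>\<^sub>M noise) \<Longrightarrow> range (Zb q) = range (Yb (fst q))"
proof -
  interpret A: prob_space A by fact
  interpret B: prob_space B by fact
  interpret AN: pair_prob_space A noise ..
  interpret BN: pair_prob_space B noise ..
  define good where "good n s \<longleftrightarrow> partial_enumeration A Ya n (fst s) \<and> partial_enumeration B Yb n (snd s) \<and>
    distr (A \<Otimes>\<^sub>M noise) real_seqs (fst s) = distr (B \<Otimes>\<^sub>M noise) real_seqs (snd s)" for n s
  define step where "step n s s' \<longleftrightarrow>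
    (\<forall>i q. i \<noteq> n \<longrightarrow> fst s' q i = fst s q i) \<and> (\<forall>i q. i \<noteq> n \<longrightarrow> snd s' q i = snd s q i) \<and>
    (even n \<longrightarrow> (\<forall>q\<in>space (A \<Otimes>\<^sub>M noise). Ya (fst q) (n div 2) \<in> fst s' q ` {..n})) \<and>
    (odd n \<longrightarrow> (\<forall>q\<in>space (B \<Otimes>\<^sub>M noise). Yb (fst q) (n div 2) \<in> snd s' q ` {..n}))"
    for n and s s' :: "('a \<times> (nat \<Rightarrow> real) \<Rightarrow> nat \<Rightarrow> real) \<times> ('b \<times> (nat \<Rightarrow> real) \<Rightarrow> nat \<Rightarrow> real)"
  have "\<exists>f. \<forall>n. good n (f n) \<and> step n (f n) (f (Suc n))"
  proof (rule dependent_nat_choice)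
    have "distr (A \<Otimes>\<^sub>M noise) real_seqs (\<lambda>_ _. 0) = distr (B \<Otimes>\<^sub>M noise) real_seqs (\<lambda>_ _. 0)"
      using AN.P.distr_const[of "\<lambda>_. 0" real_seqs] BN.P.distr_const[of "\<lambda>_. 0" real_seqs]
      by (simp add: space_PiM)
    then have "good 0 (\<lambda>_ _. 0, \<lambda>_ _. 0)"
      by (auto simp: good_def partial_enumeration_def space_PiM)
    then show "\<exists>s. good 0 s" by blast
  next
    fix s n assume "good n s"
    then have s: "partial_enumeration A Ya n (fst s)" "partial_enumeration B Yb n (snd s)"
      "distr (A \<Otimes>\<^sub>M noise) real_seqs (fst s) = distr (B \<Otimes>\<^sub>M noise) real_seqs (snd s)"
      by (auto simp: good_def)
    show "\<exists>s'. good (Suc n) s' \<and> step n s s'"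
    proof (cases "even n")
      case True
      obtain \<zeta>a' \<zeta>b' where "partial_enumeration A Ya (Suc n) \<zeta>a'" "partial_enumeration B Yb (Suc n) \<zeta>b'"
        "distr (A \<Otimes>\<^sub>M noise) real_seqs \<zeta>a' = distr (B \<Otimes>\<^sub>M noise) real_seqs \<zeta>b'"
        "\<And>q i. i \<noteq> n \<Longrightarrow> \<zeta>a' q i = fst s q i" "\<And>q i. i \<noteq> n \<Longrightarrow> \<zeta>b' q i = snd s q i"
        "\<And>q. q \<in> space (A \<Otimes>\<^sub>M noise) \<Longrightarrow> Ya (fst q) (n div 2) \<in> \<zeta>a' q ` {..n}"
        using back_and_forth_step[OF A dich_a B(1,2) dich_b s, where j="n div 2"] by blast
      then show ?thesis
        using True by (intro exI[of _ "(\<zeta>a', \<zeta>b')"]) (simp add: good_def step_def)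
    next
      case False
      obtain \<zeta>a' \<zeta>b' where "partial_enumeration B Yb (Suc n) \<zeta>b'" "partial_enumeration A Ya (Suc n) \<zeta>a'"
        "distr (B \<Otimes>\<^sub>M noise) real_seqs \<zeta>b' = distr (A \<Otimes>\<^sub>M noise) real_seqs \<zeta>a'"
        "\<And>q i. i \<noteq> n \<Longrightarrow> \<zeta>b' q i = snd s q i" "\<And>q i. i \<noteq> n \<Longrightarrow> \<zeta>a' q i = fst s q i"
        "\<And>q. q \<in> space (B \<Otimes>\<^sub>M noise) \<Longrightarrow> Yb (fst q) (n div 2) \<in> \<zeta>b' q ` {..n}"
        using back_and_forth_step[OF B dich_b A(1,2) dich_a s(2,1) s(3)[symmetric], where j="n div 2"] by blast
      then show ?thesis
        using False by (intro exI[of _ "(\<zeta>a', \<zeta>b')"]) (simp add: good_def step_def)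
    qed
  qed
  then obtain f where good: "\<And>n. good n (f n)" and step_f: "\<And>n. step n (f n) (f (Suc n))" by blast
  have Za_stable: "fst (f n) q i = fst (f (Suc i)) q i" if "i < n" for n q i
    using Suc_leI[OF that]
  proof (induction rule: dec_induct)
    case (step k)
    then have "fst (f (Suc k)) q i = fst (f k) q i"
      using step_f[of k] unfolding step_def by (metis Suc_n_not_le_n)
    then show ?case using step.IH by simp
  qed simp
  have Zb_stable: "snd (f n) q i = snd (f (Suc i)) q i" if "i < n" for n q i
    using Suc_leI[OF that]
  proof (induction rule: dec_induct)
    case (step k)
    then have "snd (f (Suc k)) q i = snd (f k) q i"
      using step_f[of k] unfolding step_def by (metis Suc_n_not_le_n)
    then show ?case using step.IH by simp
  qed simp
  define Za where "Za q i = fst (f (Suc i)) q i" for q i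
  define Zb where "Zb q i = snd (f (Suc i)) q i" for q i
  have fa[measurable]: "fst (f n) \<in> A \<Otimes>\<^sub>M noise \<rightarrow>\<^sub>M real_seqs"
    and fb[measurable]: "snd (f n) \<in> B \<Otimes>\<^sub>M noise \<rightarrow>\<^sub>M real_seqs" for n
    using good[of n] by (auto simp: good_def partial_enumeration_def)
  have Za[measurable]: "Za \<in> A \<Otimes>\<^sub>M noise \<rightarrow>\<^sub>M real_seqs"
    unfolding Za_def by (rule measurable_PiM_single') (auto simp: space_PiM)
  have Zb[measurable]: "Zb \<in> B \<Otimes>\<^sub>M noise \<rightarrow>\<^sub>M real_seqs"
    unfolding Zb_def by (rule measurable_PiM_single') (auto simp: space_PiM)
  have distr_eq: "distr (A \<Otimes>\<^sub>M noise) real_seqs Za = distr (B \<Otimes>\<^sub>M noise) real_seqs Zb"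
  proof (rule measure_eqI_PiM_infinite)
    show "finite_measure (distr (A \<Otimes>\<^sub>M noise) real_seqs Za)"
      by (rule AN.P.finite_measure_distr) simp
    fix E :: "nat \<Rightarrow> real set" and J :: "nat set"
    assume J: "finite J" and E: "\<And>i. i \<in> J \<Longrightarrow> E i \<in> sets borel"
    let ?E = "prod_emb UNIV (\<lambda>_. borel) J (Pi\<^sub>E J E)"
    have E_eq: "?E = {z. \<forall>i\<in>J. z i \<in> E i}" by (auto simp: prod_emb_def PiE_iff)
    have E_sets: "?E \<in> sets real_seqs" using J E by (intro sets_PiM_I) auto
    obtain n where n: "J \<subseteq> {..<n}" using J finite_nat_iff_bounded by blast
    have "Za -` ?E = fst (f n) -` ?E"
    proof -
      have "fst (f n) q i = Za q i" if "i \<in> J" for q i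
        using n that Za_stable[of i n q] by (auto simp: Za_def)
      then show ?thesis unfolding E_eq by auto
    qed
    moreover have "Zb -` ?E = snd (f n) -` ?E"
    proof -
      have "snd (f n) q i = Zb q i" if "i \<in> J" for q i
        using n that Zb_stable[of i n q] by (auto simp: Zb_def)
      then show ?thesis unfolding E_eq by auto
    qed
    moreover have "emeasure (distr (A \<Otimes>\<^sub>M noise) real_seqs (fst (f n))) ?E =
        emeasure (distr (B \<Otimes>\<^sub>M noise) real_seqs (snd (f n))) ?E"
      using good[of n] by (simp add: good_def)
    ultimately show "emeasure (distr (A \<Otimes>\<^sub>M noise) real_seqs Za) ?E =
        emeasure (distr (B \<Otimes>\<^sub>M noise) real_seqs Zb) ?E"
      using E_sets by (simp add: emeasure_distr)
  qed auto
  have "range (Za q) = range (Ya (fst q))" if q: "q \<in> space (A \<Otimes>\<^sub>M noise)" for q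
  proof (intro equalityI subsetI)
    fix x assume "x \<in> range (Za q)"
    then obtain i where i: "x = fst (f (Suc i)) q i" by (auto simp: Za_def)
    have "\<forall>q. \<forall>k<Suc i. fst (f (Suc i)) q k \<in> range (Ya (fst q))"
      using good[of "Suc i"] unfolding good_def partial_enumeration_def by blast
    then show "x \<in> range (Ya (fst q))" unfolding i by blast
  next
    fix x assume "x \<in> range (Ya (fst q))"
    then obtain j where x: "x = Ya (fst q) j" by auto
    have "x \<in> fst (f (Suc (2 * j))) q ` {..<Suc (2 * j)}"
      using step_f[of "2 * j"] q unfolding x step_def by (auto simp: lessThan_Suc_atMost)
    then obtain k where k: "k < Suc (2 * j)" "x = fst (f (Suc (2 * j))) q k" by blast
    have "x = Za q k" unfolding k(2) Za_def by (rule Za_stable[OF k(1)])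
    then show "x \<in> range (Za q)" by blast
  qed
  moreover have "range (Zb q) = range (Yb (fst q))" if q: "q \<in> space (B \<Otimes>\<^sub>M noise)" for q
  proof (intro equalityI subsetI)
    fix x assume "x \<in> range (Zb q)"
    then obtain i where i: "x = snd (f (Suc i)) q i" by (auto simp: Zb_def)
    have "\<forall>q. \<forall>k<Suc i. snd (f (Suc i)) q k \<in> range (Yb (fst q))"
      using good[of "Suc i"] unfolding good_def partial_enumeration_def by blast
    then show "x \<in> range (Yb (fst q))" unfolding i by blast
  next
    fix x assume "x \<in> range (Yb (fst q))"
    then obtain j where x: "x = Yb (fst q) j" by auto
    have "x \<in> snd (f (Suc (Suc (2 * j)))) q ` {..<Suc (Suc (2 * j))}"
      using step_f[of "Suc (2 * j)"] q unfolding x step_def by (auto simp: lessThan_Suc_atMost)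
    then obtain k where k: "k < Suc (Suc (2 * j))" "x = snd (f (Suc (Suc (2 * j)))) q k" by blast
    have "x = Zb q k" unfolding k(2) Zb_def by (rule Zb_stable[OF k(1)])
    then show "x \<in> range (Zb q)" by blast
  qed
  ultimately show thesis
    using that[OF Za Zb distr_eq] by blast
qed

section \<open>Realizing a joint distribution on a standard space\<close>

text \<open>
  The conditional distribution of the second coordinate given the first one, in the form of its quantile
  function: \<open>G (z, v)\<close> with uniform \<open>v\<close> has this conditional distribution. The conditional distribution functions
  \<open>F x\<close> are Radon--Nikodym derivatives, one for each \<open>x\<close> and therefore known up to null sets only, so the
  quantile is an infimum over rational levels.
\<close>

lemma conditional_quantile_function:
  fixes R :: "('s \<times> real) measure"
  assumes R: "prob_space R" and sets_R[measurable_cong]: "sets R = sets (S \<Otimes>\<^sub>M borel)"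
  obtains G where "G \<in> borel_measurable (S \<Otimes>\<^sub>M unif)"
    "distr (distr R S fst \<Otimes>\<^sub>M unif) (S \<Otimes>\<^sub>M borel) (\<lambda>w. (fst w, G w)) = R"
proof -
  interpret R: prob_space R by fact
  have space_R: "space R = space S \<times> UNIV"
    using sets_eq_imp_space_eq[OF sets_R] by (simp add: space_pair_measure)
  define \<nu> where "\<nu> = distr R S fst"
  have sets_\<nu>[simp, measurable_cong]: "sets \<nu> = sets S" and space_\<nu>[simp]: "space \<nu> = space S"
    by (simp_all add: \<nu>_def)
  interpret \<nu>: prob_space \<nu> unfolding \<nu>_def by (rule R.prob_space_distr) simp
  interpret \<nu>U: pair_prob_space \<nu> unif ..
  let ?W = "\<nu> \<Otimes>\<^sub>M unif"
  have "\<exists>F\<in>borel_measurable S. \<forall>C\<in>sets S. (\<integral>\<^sup>+z. F z * indicator C z \<partial>\<nu>) = emeasure R (C \<times> {..x})" for x :: real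
  proof -
    define \<mu> where "\<mu> = distr (density R (indicator (space S \<times> {..x}))) S fst"
    have \<mu>: "emeasure \<mu> C = emeasure R (C \<times> {..x})" if C[measurable]: "C \<in> sets S" for C
    proof -
      have "emeasure \<mu> C = (\<integral>\<^sup>+w. indicator (space S \<times> {..x}) w * indicator (fst -` C \<inter> space R) w \<partial>R)"
        unfolding \<mu>_def by (subst emeasure_distr) (auto simp: emeasure_density)
      also have "\<dots> = (\<integral>\<^sup>+w. indicator (C \<times> {..x}) w \<partial>R)"
        using sets.sets_into_space[OF C]
        by (intro nn_integral_cong) (auto simp: space_R split: split_indicator)
      finally show ?thesis by simp
    qed
    have "absolutely_continuous \<nu> \<mu>"
      unfolding absolutely_continuous_def
    proof
      fix C assume C: "C \<in> null_sets \<nu>"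
      then have [measurable]: "C \<in> sets S" by auto
      have "emeasure R (C \<times> {..x}) \<le> emeasure R (fst -` C \<inter> space R)"
        using sets.sets_into_space[of C S] by (intro emeasure_mono) (auto simp: space_R)
      also have "\<dots> = emeasure \<nu> C" by (simp add: \<nu>_def emeasure_distr)
      finally show "C \<in> null_sets \<mu>"
        using C by (auto simp: null_sets_def \<mu>) (simp add: \<mu>_def)
    qed
    then obtain F where F[measurable]: "F \<in> borel_measurable \<nu>" and F_eq: "density \<nu> F = \<mu>"
      using \<nu>.Radon_Nikodym[of \<mu>] by (auto simp: \<mu>_def)
    have "(\<integral>\<^sup>+z. F z * indicator C z \<partial>\<nu>) = emeasure R (C \<times> {..x})" if "C \<in> sets S" for C
      using \<mu>[OF that] that unfolding F_eq[symmetric] by (simp add: emeasure_density)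
    moreover have "F \<in> borel_measurable S" using F by (simp cong: measurable_cong_sets)
    ultimately show ?thesis by blast
  qed
  then obtain F where F[measurable]: "\<And>x. F x \<in> borel_measurable S"
    and F_int: "\<And>x C. C \<in> sets S \<Longrightarrow> (\<integral>\<^sup>+z. F x z * indicator C z \<partial>\<nu>) = emeasure R (C \<times> {..x})"
    by metis
  have F_fin: "(\<integral>\<^sup>+z. F x z \<partial>\<nu>) \<noteq> \<infinity>" for x
  proof -
    have "(\<integral>\<^sup>+z. F x z \<partial>\<nu>) = (\<integral>\<^sup>+z. F x z * indicator (space S) z \<partial>\<nu>)"
      by (intro nn_integral_cong) simp
    then show ?thesis using F_int[of "space S" x] by simp
  qed
  have F_mono: "AE z in \<nu>. F x z \<le> F y z" if "x \<le> y" for x y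
    using that by (intro AE_le_if_nn_integral_le F_fin) (auto simp: F_int intro!: emeasure_mono)
  have F_le1: "AE z in \<nu>. F x z \<le> 1" for x
  proof (rule AE_le_if_nn_integral_le)
    fix C assume C: "C \<in> sets \<nu>"
    then have [measurable]: "C \<in> sets S" by simp
    have "emeasure R (C \<times> {..x}) \<le> emeasure R (fst -` C \<inter> space R)"
      using sets.sets_into_space[of C S] by (intro emeasure_mono) (auto simp: space_R)
    also have "\<dots> = emeasure \<nu> C" by (simp add: \<nu>_def emeasure_distr)
    finally show "(\<integral>\<^sup>+z. F x z * indicator C z \<partial>\<nu>) \<le> (\<integral>\<^sup>+z. 1 * indicator C z \<partial>\<nu>)"
      using C by (simp add: F_int)
  qed (auto simp: \<nu>.emeasure_space_1)
  have below: "emeasure ?W {w\<in>space ?W. fst w \<in> C \<and> ennreal (snd w) < F x (fst w)} = emeasure R (C \<times> {..x})"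
    if C[measurable]: "C \<in> sets S" for C x
  proof -
    let ?A = "{w\<in>space ?W. fst w \<in> C \<and> ennreal (snd w) < F x (fst w)}"
    have A: "?A \<in> sets ?W" by measurable
    have "emeasure ?W ?A = (\<integral>\<^sup>+z. emeasure unif (Pair z -` ?A) \<partial>\<nu>)"
      by (rule unif.emeasure_pair_measure_alt[OF A])
    also have "\<dots> = (\<integral>\<^sup>+z. F x z * indicator C z \<partial>\<nu>)"
    proof (rule nn_integral_cong_AE)
      show "AE z in \<nu>. emeasure unif (Pair z -` ?A) = F x z * indicator C z"
        using F_le1[of x] AE_space
      proof eventually_elim
        case (elim z)
        then have "Pair z -` ?A = (if z \<in> C then {v. 0 \<le> ennreal v \<and> ennreal v < F x z} else {})"
          by (auto simp: space_pair_measure)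
        then show ?case
          using emeasure_unif_interval[of 0 "F x z"] elim by simp
      qed
    qed
    finally show ?thesis using F_int[OF C] by simp
  qed
  \<comment> \<open>Extended real values, since the infimum may be infinite on a null set.\<close>
  define H where "H w = (INF q\<in>\<rat>. if ennreal (snd w) < F q (fst w) then ereal q else \<infinity>)" for w
  have H[measurable]: "H \<in> borel_measurable ?W"
    unfolding H_def by (rule borel_measurable_INF) (auto simp: countable_rat)
  have H_less: "H w < ereal x \<longleftrightarrow> (\<exists>q\<in>\<rat>. q < x \<and> ennreal (snd w) < F q (fst w))" for w x
    unfolding H_def INF_less_iff by (auto split: if_splits)
  define L where "L C x = emeasure ?W {w\<in>space ?W. fst w \<in> C \<and> H w < ereal x}" for C x
  have H_sets: "{w\<in>space ?W. fst w \<in> C \<and> H w < ereal x} \<in> sets ?W" if [measurable]: "C \<in> sets S" for C x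
    by measurable
  have fin_sets: "{w\<in>space ?W. H w \<noteq> \<infinity>} \<in> sets ?W" "{w\<in>space ?W. H w = - \<infinity>} \<in> sets ?W"
    by measurable
  have L_le: "L C x \<le> emeasure R (C \<times> {..x})" if C[measurable]: "C \<in> sets S" for C x
  proof -
    have "AE z in \<nu>. \<forall>q\<in>\<rat>. q < x \<longrightarrow> F q z \<le> F x z"
      by (intro AE_ball_countable[OF countable_rat, THEN iffD2] ballI AE_impI F_mono) auto
    then have "AE w in ?W. \<forall>q\<in>\<rat>. q < x \<longrightarrow> F q (fst w) \<le> F x (fst w)"
    proof -
      assume *: "AE z in \<nu>. \<forall>q\<in>\<rat>. q < x \<longrightarrow> F q z \<le> F x z"
      have "AE z in distr ?W \<nu> fst. \<forall>q\<in>\<rat>. q < x \<longrightarrow> F q z \<le> F x z"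
        unfolding unif.distr_pair_fst by (rule *)
      then show ?thesis by (rule AE_distrD[rotated]) simp
    qed
    then have "L C x \<le> emeasure ?W {w\<in>space ?W. fst w \<in> C \<and> ennreal (snd w) < F x (fst w)}"
      unfolding L_def
    proof (intro emeasure_mono_AE, goal_cases)
      case 1
      then show ?case
        by eventually_elim (auto simp: H_less intro: less_le_trans)
    qed measurable
    then show ?thesis by (simp add: below)
  qed
  have L_ge: "emeasure R (C \<times> {..q}) \<le> L C x" if C[measurable]: "C \<in> sets S" and q: "q \<in> \<rat>" "q < x" for C q x
    unfolding below[OF C, symmetric] L_def
  proof (rule emeasure_mono)
    show "{w\<in>space ?W. fst w \<in> C \<and> ennreal (snd w) < F q (fst w)} \<subseteq>
        {w\<in>space ?W. fst w \<in> C \<and> H w < ereal x}"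
      using q by (auto simp: H_less)
  qed measurable
  have x_lim: "(\<lambda>n. x - 1 / real (Suc n)) \<longlonglongrightarrow> x" for x
    using tendsto_diff[OF tendsto_const LIMSEQ_inverse_real_of_nat, of x] by (simp add: inverse_eq_divide)
  have inc: "x - 1 / real (Suc m) \<le> x - 1 / real (Suc n)" if "m \<le> n" for m n x
    using that by (simp add: frac_le)
  have ex: "y < x \<Longrightarrow> \<exists>n. y < x - 1 / real (Suc n)" for x y
    using order_tendstoD(1)[OF x_lim, of y x] by (auto simp: eventually_sequentially)
  \<comment> \<open>\<open>L C x\<close> lies between the masses of \<open>C \<times> {..y}\<close> and \<open>C \<times> {..x}\<close> for all \<open>y < x\<close>, and is left continuous in \<open>x\<close>.\<close>
  have L_eq: "L C x = emeasure R (C \<times> {..<x})" if C[measurable]: "C \<in> sets S" for C x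
  proof (rule antisym)
    define y where "y n = x - 1 / real (Suc n)" for n
    have y_mono: "y m \<le> y n" if "m \<le> n" for m n
      unfolding y_def by (rule inc[OF that])
    have R_lim: "(\<lambda>n. emeasure R (C \<times> {..y n})) \<longlonglongrightarrow> emeasure R (C \<times> {..<x})"
    proof -
      have "(\<Union>n. C \<times> {..y n}) = C \<times> {..<x}"
      proof -
        have "b < x" if "b \<le> y n" for b n using that by (rule le_less_trans) (simp add: y_def)
        moreover have "\<exists>n. b \<le> y n" if "b < x" for b
          using ex[OF that] unfolding y_def by (auto intro: less_imp_le)
        ultimately show ?thesis by blast
      qed
      moreover have "incseq (\<lambda>n. C \<times> {..y n})"
        by (auto simp: incseq_def intro: order_trans y_mono)
      moreover have "range (\<lambda>n. C \<times> {..y n}) \<subseteq> sets R" by (auto simp: sets_R)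
      ultimately show ?thesis
        using Lim_emeasure_incseq[of "\<lambda>n. C \<times> {..y n}" R] by simp
    qed
    have L_lim: "(\<lambda>n. L C (y n)) \<longlonglongrightarrow> L C x"
    proof -
      let ?A = "\<lambda>n. {w\<in>space ?W. fst w \<in> C \<and> H w < ereal (y n)}"
      have "(\<Union>n. ?A n) = {w\<in>space ?W. fst w \<in> C \<and> H w < ereal x}"
      proof -
        have "H w < ereal x \<longleftrightarrow> (\<exists>n. H w < ereal (y n))" for w
        proof
          assume "H w < ereal x"
          then obtain q where q: "q \<in> \<rat>" "q < x" "ennreal (snd w) < F q (fst w)" by (auto simp: H_less)
          then obtain n where "q < y n" using ex by (auto simp: y_def)
          then show "\<exists>n. H w < ereal (y n)" using q by (auto simp: H_less)
        next
          assume "\<exists>n. H w < ereal (y n)"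
          then obtain n where "H w < ereal (y n)" ..
          also have "\<dots> < ereal x" by (simp add: y_def)
          finally show "H w < ereal x" .
        qed
        then show ?thesis by auto
      qed
      moreover have "incseq ?A"
        using y_mono by (fastforce simp: incseq_def intro: less_le_trans)
      moreover have "range ?A \<subseteq> sets ?W" using H_sets[OF C] by blast
      ultimately show ?thesis
        using Lim_emeasure_incseq[of ?A ?W] by (simp add: L_def)
    qed
    show "L C x \<le> emeasure R (C \<times> {..<x})"
      using L_lim R_lim by (rule LIMSEQ_le) (auto intro: L_le C)
    show "emeasure R (C \<times> {..<x}) \<le> L C x"
    proof (rule LIMSEQ_le_const2[OF R_lim], intro exI allI impI)
      fix n
      obtain q where q: "q \<in> \<rat>" "y n < q" "q < x"
        using Rats_dense_in_real[of "y n" x] by (auto simp: y_def)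
      have "emeasure R (C \<times> {..y n}) \<le> emeasure R (C \<times> {..q})"
        using q by (intro emeasure_mono) (auto simp: sets_R)
      also have "\<dots> \<le> L C x" by (rule L_ge[OF C q(1,3)])
      finally show "emeasure R (C \<times> {..y n}) \<le> L C x" .
    qed
  qed
  have top: "AE w in ?W. H w \<noteq> \<infinity>"
  proof -
    have "(\<lambda>n. emeasure R (space S \<times> {..<real n})) \<longlonglongrightarrow> emeasure R (\<Union>n. space S \<times> {..<real n})"
      by (rule Lim_emeasure_incseq) (auto simp: incseq_def sets_R)
    also have "(\<Union>n. space S \<times> {..<real n}) = space R"
      using reals_Archimedean2 by (auto simp: space_R)
    finally have lim: "(\<lambda>n. emeasure R (space S \<times> {..<real n})) \<longlonglongrightarrow> 1"
      by (simp add: R.emeasure_space_1)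
    have "1 \<le> emeasure ?W {w\<in>space ?W. H w \<noteq> \<infinity>}"
    proof (rule LIMSEQ_le_const2[OF lim], intro exI allI impI)
      fix n
      have "emeasure R (space S \<times> {..<real n}) = L (space S) (real n)" by (simp add: L_eq)
      also have "\<dots> \<le> emeasure ?W {w\<in>space ?W. H w \<noteq> \<infinity>}"
        unfolding L_def by (intro emeasure_mono fin_sets) auto
      finally show "emeasure R (space S \<times> {..<real n}) \<le> emeasure ?W {w\<in>space ?W. H w \<noteq> \<infinity>}" .
    qed
    then have "\<nu>U.P.prob {w\<in>space ?W. H w \<noteq> \<infinity>} = 1"
      using \<nu>U.P.prob_le_1[of "{w\<in>space ?W. H w \<noteq> \<infinity>}"] by (simp add: \<nu>U.P.emeasure_eq_measure)
    then show ?thesis using \<nu>U.P.prob_Collect_eq_1[OF fin_sets(1)] by simp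
  qed
  have bot: "AE w in ?W. H w \<noteq> - \<infinity>"
  proof -
    have "(\<lambda>n. emeasure R (space S \<times> {..<- real n})) \<longlonglongrightarrow> emeasure R (\<Inter>n. space S \<times> {..<- real n})"
      by (rule Lim_emeasure_decseq) (auto simp: decseq_def sets_R)
    also have "(\<Inter>n. space S \<times> {..<- real n}) = {}"
    proof -
      have "\<exists>n. \<not> y < - real n" for y :: real
      proof -
        obtain n where "- y < real n" using reals_Archimedean2 by blast
        then have "\<not> y < - real n" by linarith
        then show ?thesis ..
      qed
      then show ?thesis by fastforce
    qed
    finally have lim: "(\<lambda>n. emeasure R (space S \<times> {..<- real n})) \<longlonglongrightarrow> 0" by simp
    have "emeasure ?W {w\<in>space ?W. H w = - \<infinity>} \<le> 0"
    proof (rule LIMSEQ_le_const[OF lim], intro exI allI impI)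
      fix n
      have "emeasure ?W {w\<in>space ?W. H w = - \<infinity>} \<le> L (space S) (- real n)"
        unfolding L_def by (intro emeasure_mono H_sets) (auto simp: space_pair_measure)
      then show "emeasure ?W {w\<in>space ?W. H w = - \<infinity>} \<le> emeasure R (space S \<times> {..<- real n})"
        by (simp add: L_eq)
    qed
    then show ?thesis using fin_sets(2) by (subst AE_iff_measurable[OF _ refl]) simp_all
  qed
  define G where "G w = real_of_ereal (H w)" for w
  have G: "G \<in> borel_measurable ?W" unfolding G_def by measurable
  then have "distr ?W (S \<Otimes>\<^sub>M borel) (\<lambda>w. (fst w, G w)) = R"
  proof -
    have law: "(\<lambda>w. (fst w, G w)) \<in> ?W \<rightarrow>\<^sub>M S \<Otimes>\<^sub>M borel" using G by measurable
    let ?E = "{C \<times> {..<x :: real} | C x. C \<in> sets S}"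
    have gen: "sets (S \<Otimes>\<^sub>M (borel :: real measure)) = sigma_sets (space S \<times> UNIV) ?E"
    proof -
      have "sets (S \<Otimes>\<^sub>M (borel :: real measure)) =
          sets (sigma (space S \<times> space borel) {a \<times> b | a b. a \<in> sets S \<and> b \<in> range lessThan})"
      proof (rule sets_pair_eq)
        show "sets (borel :: real measure) = sigma_sets (space borel) (range lessThan)"
          by (subst borel_Iio) (simp add: sets_measure_of)
        show "countable {space S}" "{space S} \<subseteq> sets S" "\<Union> {space S} = space S" by auto
        show "countable (range (\<lambda>n. {..<real n}))" "range (\<lambda>n. {..<real n}) \<subseteq> range lessThan" by auto
        show "\<Union> (range (\<lambda>n. {..<real n})) = space borel" using reals_Archimedean2 by auto
      qed (auto simp: sets.sigma_sets_eq sets.space_closed)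
      also have "{a \<times> b | a b. a \<in> sets S \<and> b \<in> range (lessThan :: real \<Rightarrow> real set)} = ?E" by auto
      finally show ?thesis
        using sets.sets_into_space[of _ S] by (subst (asm) sets_measure_of) auto
    qed
    show ?thesis
    proof (rule measure_eqI_generator_eq[where E="?E" and \<Omega>="space S \<times> UNIV" and A="\<lambda>n. space S \<times> {..<real n}"])
      show "Int_stable ?E"
      proof (rule Int_stableI)
        fix a b assume "a \<in> ?E" "b \<in> ?E"
        then obtain C x D y where "a = C \<times> {..<x}" "b = D \<times> {..<y}" "C \<in> sets S" "D \<in> sets S" by auto
        then have "a \<inter> b = (C \<inter> D) \<times> {..<min x y}" "C \<inter> D \<in> sets S" by auto
        then show "a \<inter> b \<in> ?E" by blast
      qed
      show "?E \<subseteq> Pow (space S \<times> UNIV)" using sets.sets_into_space by auto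
      show "sets (distr ?W (S \<Otimes>\<^sub>M borel) (\<lambda>w. (fst w, G w))) = sigma_sets (space S \<times> UNIV) ?E"
        "sets R = sigma_sets (space S \<times> UNIV) ?E" by (simp_all add: gen sets_R)
      show "range (\<lambda>n. space S \<times> {..<real n}) \<subseteq> ?E" by auto
      show "(\<Union>n. space S \<times> {..<real n}) = space S \<times> UNIV" using reals_Archimedean2 by auto
      show "emeasure (distr ?W (S \<Otimes>\<^sub>M borel) (\<lambda>w. (fst w, G w))) (space S \<times> {..<real n}) \<noteq> \<infinity>" for n
        using prob_space.emeasure_le_1[OF \<nu>U.P.prob_space_distr[OF law], of "space S \<times> {..<real n}"]
        by (auto simp: top_unique)
      fix E assume "E \<in> ?E"
      then obtain C x where E: "E = C \<times> {..<x}" and C[measurable]: "C \<in> sets S" by auto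
      have "emeasure (distr ?W (S \<Otimes>\<^sub>M borel) (\<lambda>w. (fst w, G w))) E =
          emeasure ?W {w\<in>space ?W. fst w \<in> C \<and> G w < x}"
        unfolding E by (subst emeasure_distr[OF law]) (auto intro!: arg_cong[where f="emeasure ?W"])
      also have "\<dots> = L C x"
        unfolding L_def
      proof (rule emeasure_eq_AE)
        show "AE w in ?W. w \<in> {w\<in>space ?W. fst w \<in> C \<and> G w < x} \<longleftrightarrow> w \<in> {w\<in>space ?W. fst w \<in> C \<and> H w < ereal x}"
          using top bot
        proof eventually_elim
          case (elim w)
          then show ?case by (cases "H w") (auto simp: G_def)
        qed
      qed (use G in measurable)
      finally show "emeasure (distr ?W (S \<Otimes>\<^sub>M borel) (\<lambda>w. (fst w, G w))) E = emeasure R E"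
        by (simp add: L_eq E)
    qed
  qed
  with G show thesis
    by (intro that[of G]) (auto simp: \<nu>_def cong: measurable_cong_sets)
qed

text \<open>
  All that is used of a standard space: its points can be encoded by real numbers. The decoding is measurable
  only for the completed distribution of the code, because the space itself is complete.
\<close>

lemma standard_prob_space_real_code:
  fixes M :: "'a measure"
  assumes "standard_prob_space M"
  obtains f :: "'a \<Rightarrow> real" and g :: "real \<Rightarrow> 'a"
  where "f \<in> borel_measurable M" "g \<in> completion (distr M borel f) \<rightarrow>\<^sub>M M"
    "AE \<omega> in M. g (f \<omega>) = \<omega>"
proof -
  interpret M: prob_space M using assms by (simp add: standard_prob_space_def)
  obtain N where N: "interval_with_atoms N" "isomorphic_mod0 M (completion N)"
    using assms by (auto simp: standard_prob_space_def)
  have sets_N: "sets N = sets borel" using N(1) by (simp add: interval_with_atoms_def)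
  obtain A B f0 g0 where A[measurable]: "A \<in> sets M" and B: "B \<in> sets (completion N)"
    and nullA: "space M - A \<in> null_sets M" and nullB: "space (completion N) - B \<in> null_sets (completion N)"
    and f0: "f0 \<in> restrict_space M A \<rightarrow>\<^sub>M restrict_space (completion N) B"
    and g0: "g0 \<in> restrict_space (completion N) B \<rightarrow>\<^sub>M restrict_space M A"
    and inv: "\<And>x. x \<in> A \<Longrightarrow> g0 (f0 x) = x"
    and distr: "distr (restrict_space M A) (restrict_space (completion N) B) f0 = restrict_space (completion N) B"
    using N(2) unfolding isomorphic_mod0_def by blast
  obtain \<omega>0 where \<omega>0: "\<omega>0 \<in> space M" using M.not_empty by blast
  have space_A: "A \<inter> space M = A" using sets.sets_into_space[OF A] by auto
  have space_B: "B \<inter> space N = B" using sets.sets_into_space[OF B] by auto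
  have f0_B: "f0 x \<in> B" if "x \<in> A" for x
    using measurable_space[OF f0, of x] that space_A space_B by (auto simp: space_restrict_space)
  have "f0 \<in> restrict_space M A \<rightarrow>\<^sub>M completion N"
    using f0 by (simp add: measurable_restrict_space2_iff)
  moreover have "(\<lambda>x. x) \<in> completion N \<rightarrow>\<^sub>M N" by (rule measurable_completion) simp
  ultimately have "f0 \<in> restrict_space M A \<rightarrow>\<^sub>M N" by (rule measurable_compose)
  then have f0_borel: "f0 \<in> borel_measurable (restrict_space M A)"
    by (simp add: sets_N cong: measurable_cong_sets)
  define f where "f x = (if x \<in> A then f0 x else 0)" for x
  define g where "g r = (if r \<in> B then g0 r else \<omega>0)" for r
  have f[measurable]: "f \<in> borel_measurable M"
    unfolding f_def using f0_borel by (subst measurable_If_restrict_space_iff) auto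
  have distr_f: "distr M borel f = N"
  proof (rule measure_eqI)
    fix E assume "E \<in> sets (distr M borel f)"
    then have E[measurable]: "E \<in> sets borel" and E_N: "E \<in> sets N" by (auto simp: sets_N)
    have E_B: "E \<inter> B \<in> sets (completion N)" using B E_N by auto
    then have E_B': "E \<inter> B \<in> sets (restrict_space (completion N) B)"
      using B by (auto simp: sets_restrict_space_iff space_B)
    have "emeasure (distr M borel f) E = emeasure M (f -` E \<inter> space M)"
      by (simp add: emeasure_distr)
    also have "\<dots> = emeasure M (f0 -` (E \<inter> B) \<inter> A)"
    proof (rule emeasure_eq_AE)
      show "AE x in M. x \<in> f -` E \<inter> space M \<longleftrightarrow> x \<in> f0 -` (E \<inter> B) \<inter> A"
        using AE_not_in[OF nullA] AE_space by eventually_elim (auto simp: f_def f0_B)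
      have "f0 -` (E \<inter> B) \<inter> space (restrict_space M A) \<in> sets (restrict_space M A)"
        by (rule measurable_sets[OF f0 E_B'])
      then show "f0 -` (E \<inter> B) \<inter> A \<in> sets M"
        by (simp add: space_restrict_space space_A sets_restrict_space_iff)
    qed measurable
    also have "\<dots> = emeasure (restrict_space M A) (f0 -` (E \<inter> B) \<inter> space (restrict_space M A))"
      by (simp add: space_restrict_space space_A emeasure_restrict_space)
    also have "\<dots> = emeasure (restrict_space (completion N) B) (E \<inter> B)"
      by (subst distr[symmetric]) (rule emeasure_distr[OF f0 E_B', symmetric])
    also have "\<dots> = emeasure (completion N) (E \<inter> B)"
      using B by (intro emeasure_restrict_space) (auto simp: space_B)
    also have "\<dots> = emeasure (completion N) E"
    proof (rule emeasure_eq_AE)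
      show "AE x in completion N. x \<in> E \<inter> B \<longleftrightarrow> x \<in> E"
        using AE_not_in[OF nullB] AE_space by eventually_elim auto
    qed (use E_B E_N in auto)
    finally show "emeasure (distr M borel f) E = emeasure N E" using E_N by simp
  qed (simp add: sets_N)
  have g: "g \<in> completion N \<rightarrow>\<^sub>M M"
    unfolding g_def
  proof (subst measurable_If_restrict_space_iff)
    have "{x\<in>space (completion N). x \<in> B} = B" using space_B by auto
    then show "{x\<in>space (completion N). x \<in> B} \<in> sets (completion N)" using B by simp
    show "g0 \<in> restrict_space (completion N) {x. x \<in> B} \<rightarrow>\<^sub>M M \<and>
        (\<lambda>x. \<omega>0) \<in> restrict_space (completion N) {x. x \<notin> B} \<rightarrow>\<^sub>M M"
      using g0 \<omega>0 by (simp add: measurable_restrict_space2_iff)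
  qed
  have "AE \<omega> in M. g (f \<omega>) = \<omega>"
    using AE_not_in[OF nullA] AE_space by eventually_elim (auto simp: f_def g_def f0_B inv)
  with f g show thesis by (intro that[of f g]) (simp_all add: distr_f)
qed

lemma measurable_compose_completion:
  assumes X: "X \<in> A \<rightarrow>\<^sub>M B" and g: "g \<in> completion (distr A B X) \<rightarrow>\<^sub>M C"
  shows "(\<lambda>w. g (X w)) \<in> completion A \<rightarrow>\<^sub>M C"
proof -
  have "X \<in> completion A \<rightarrow>\<^sub>M completion (distr A B X)"
  proof (rule completion.measurable_completion2)
    show "X \<in> completion A \<rightarrow>\<^sub>M distr A B X"
      using measurable_completion[OF X] by simp
    have "distr (completion A) (distr A B X) X = distr A B X"
      using distr_completion[of X A "distr A B X"] X by (simp cong: distr_cong)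
    then show "null_sets (distr A B X) \<subseteq> null_sets (distr (completion A) (distr A B X) X)"
      by simp
  qed
  then show ?thesis using g by (rule measurable_compose)
qed

text \<open>
  A standard space admits conditional distributions: given the first coordinate \<open>z\<close> of \<open>P\<close>, a uniform
  variable suffices to draw a second coordinate with the right joint distribution. The real code of the point is
  drawn by the conditional quantile function and then decoded.
\<close>

lemma conditional_realization:
  fixes P :: "('s \<times> 'a) measure"
  assumes M: "standard_prob_space M"
    and P: "prob_space P" and sets_P[measurable_cong]: "sets P = sets (S \<Otimes>\<^sub>M M)"
    and marginal: "distr P M snd = M"
  obtains h where "h \<in> completion (distr P S fst \<Otimes>\<^sub>M unif) \<rightarrow>\<^sub>M M"
    "distr (completion (distr P S fst \<Otimes>\<^sub>M unif)) (S \<Otimes>\<^sub>M M) (\<lambda>w. (fst w, h w)) = P"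
proof -
  interpret P: prob_space P by fact
  interpret M: prob_space M using M by (simp add: standard_prob_space_def)
  obtain f :: "'a \<Rightarrow> real" and g where f[measurable]: "f \<in> borel_measurable M"
    and g: "g \<in> completion (distr M borel f) \<rightarrow>\<^sub>M M" and gf: "AE \<omega> in M. g (f \<omega>) = \<omega>"
    using standard_prob_space_real_code[OF M] by blast
  define \<nu> where "\<nu> = distr P S fst"
  have sets_\<nu>[simp, measurable_cong]: "sets \<nu> = sets S" by (simp add: \<nu>_def)
  interpret \<nu>: prob_space \<nu> unfolding \<nu>_def by (rule P.prob_space_distr) simp
  interpret \<nu>U: pair_prob_space \<nu> unif ..
  let ?W = "\<nu> \<Otimes>\<^sub>M unif"
  define R where "R = distr P (S \<Otimes>\<^sub>M borel) (\<lambda>p. (fst p, f (snd p)))"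
  have R: "prob_space R" unfolding R_def by (rule P.prob_space_distr) measurable
  have sets_R: "sets R = sets (S \<Otimes>\<^sub>M borel)" by (simp add: R_def)
  have "distr R S fst = \<nu>"
    unfolding R_def \<nu>_def by (subst distr_distr) (auto simp: comp_def)
  then obtain G where G[measurable]: "G \<in> borel_measurable (S \<Otimes>\<^sub>M unif)"
    and G_law: "distr ?W (S \<Otimes>\<^sub>M borel) (\<lambda>w. (fst w, G w)) = R"
    using conditional_quantile_function[OF R sets_R] by metis
  have G'[measurable]: "G \<in> borel_measurable ?W"
    using G by (simp cong: measurable_cong_sets)
  have "distr ?W borel G = distr R borel snd"
    unfolding G_law[symmetric] by (subst distr_distr) (auto simp: comp_def)
  also have "\<dots> = distr P borel (\<lambda>p. f (snd p))"
    unfolding R_def by (subst distr_distr) (auto simp: comp_def)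
  also have "\<dots> = distr (distr P M snd) borel f"
    by (subst distr_distr) (auto simp: comp_def)
  finally have G_f: "distr ?W borel G = distr M borel f" by (simp add: marginal)
  define h where "h w = g (G w)" for w
  have h: "h \<in> completion ?W \<rightarrow>\<^sub>M M"
    unfolding h_def by (rule measurable_compose_completion[OF G']) (simp add: G_f g)
  have fst_W: "fst \<in> completion ?W \<rightarrow>\<^sub>M S"
    by (rule measurable_completion) measurable
  have law: "(\<lambda>w. (fst w, h w)) \<in> completion ?W \<rightarrow>\<^sub>M S \<Otimes>\<^sub>M M"
    using fst_W h by (rule measurable_Pair)
  have "distr (completion ?W) (S \<Otimes>\<^sub>M M) (\<lambda>w. (fst w, h w)) = P"
  proof (rule measure_eqI_generator_eq[where E="{C \<times> E | C E. C \<in> sets S \<and> E \<in> sets M}" and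
        \<Omega>="space S \<times> space M" and A="\<lambda>_. space S \<times> space M"])
    show "Int_stable {C \<times> E | C E. C \<in> sets S \<and> E \<in> sets M}"
      by (rule Int_stable_pair_measure_generator)
    show "{C \<times> E | C E. C \<in> sets S \<and> E \<in> sets M} \<subseteq> Pow (space S \<times> space M)"
      by (rule pair_measure_closed)
    show "sets (distr (completion ?W) (S \<Otimes>\<^sub>M M) (\<lambda>w. (fst w, h w))) =
        sigma_sets (space S \<times> space M) {C \<times> E | C E. C \<in> sets S \<and> E \<in> sets M}"
      "sets P = sigma_sets (space S \<times> space M) {C \<times> E | C E. C \<in> sets S \<and> E \<in> sets M}"
      by (simp_all add: sets_P sets_pair_measure)
    have "prob_space (distr (completion ?W) (S \<Otimes>\<^sub>M M) (\<lambda>w. (fst w, h w)))"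
      by (intro prob_space.prob_space_distr[OF _ law] \<nu>U.P.prob_space_completion)
    then show "emeasure (distr (completion ?W) (S \<Otimes>\<^sub>M M) (\<lambda>w. (fst w, h w))) (space S \<times> space M) \<noteq> \<infinity>" for n
      using prob_space.emeasure_le_1[of "distr (completion ?W) (S \<Otimes>\<^sub>M M) (\<lambda>w. (fst w, h w))" "space S \<times> space M"]
      by (auto simp: top_unique)
    fix X assume "X \<in> {C \<times> E | C E. C \<in> sets S \<and> E \<in> sets M}"
    then obtain C E where X: "X = C \<times> E" and C[measurable]: "C \<in> sets S" and E[measurable]: "E \<in> sets M" by auto
    \<comment> \<open>A Borel set that agrees with the code of \<open>E\<close> up to a null set.\<close>
    have "g -` E \<inter> space (completion (distr M borel f)) \<in> sets (completion (distr M borel f))"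
      by (rule measurable_sets[OF g E])
    then have "g -` E \<in> sets (completion (distr M borel f))" by simp
    then obtain E0 N0 N1 where E0: "g -` E = E0 \<union> N0" "N0 \<subseteq> N1" "N1 \<in> null_sets (distr M borel f)"
      and E0_sets: "E0 \<in> sets (distr M borel f)"
      by (rule sets_completionE) blast
    have [measurable]: "E0 \<in> sets borel" using E0_sets by simp
    have N1: "AE r in distr M borel f. r \<notin> N1" by (rule AE_not_in[OF E0(3)])
    have W_N1: "AE w in ?W. G w \<notin> N1"
      using N1 unfolding G_f[symmetric] by (rule AE_distrD[OF G'])
    have "AE \<omega> in M. f \<omega> \<notin> N1"
      using N1 by (rule AE_distrD[OF f])
    then have "AE \<omega> in M. f \<omega> \<in> E0 \<longleftrightarrow> \<omega> \<in> E"
      using gf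
    proof eventually_elim
      case (elim \<omega>)
      then have "f \<omega> \<in> E0 \<longleftrightarrow> f \<omega> \<in> g -` E" using E0(1,2) by auto
      then show ?case using elim(2) by simp
    qed
    then have "AE \<omega> in distr P M snd. f \<omega> \<in> E0 \<longleftrightarrow> \<omega> \<in> E" unfolding marginal .
    then have P_E: "AE p in P. f (snd p) \<in> E0 \<longleftrightarrow> snd p \<in> E" by (rule AE_distrD[rotated]) simp
    have A0: "{w\<in>space ?W. fst w \<in> C \<and> G w \<in> E0} \<in> sets ?W" by measurable
    have "emeasure (distr (completion ?W) (S \<Otimes>\<^sub>M M) (\<lambda>w. (fst w, h w))) X =
        emeasure (completion ?W) ((\<lambda>w. (fst w, h w)) -` X \<inter> space (completion ?W))"
      unfolding X by (intro emeasure_distr law) simp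
    also have "\<dots> = emeasure (completion ?W) {w\<in>space ?W. fst w \<in> C \<and> G w \<in> E0}"
    proof (rule emeasure_eq_AE)
      show "AE w in completion ?W. w \<in> (\<lambda>w. (fst w, h w)) -` X \<inter> space (completion ?W) \<longleftrightarrow>
          w \<in> {w\<in>space ?W. fst w \<in> C \<and> G w \<in> E0}"
        using AE_completion[OF W_N1]
      proof eventually_elim
        case (elim w)
        have "G w \<in> g -` E \<longleftrightarrow> G w \<in> E0" using elim E0(1,2) by auto
        then show ?case by (auto simp: X h_def)
      qed
      show "(\<lambda>w. (fst w, h w)) -` X \<inter> space (completion ?W) \<in> sets (completion ?W)"
        unfolding X by (intro measurable_sets[OF law]) simp
      show "{w\<in>space ?W. fst w \<in> C \<and> G w \<in> E0} \<in> sets (completion ?W)"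
        by (rule sets_completionI_sets[OF A0])
    qed
    also have "\<dots> = emeasure ?W {w\<in>space ?W. fst w \<in> C \<and> G w \<in> E0}"
      by (simp only: emeasure_completion[OF sets_completionI_sets[OF A0]] main_part[OF A0])
    also have "{w\<in>space ?W. fst w \<in> C \<and> G w \<in> E0} = (\<lambda>w. (fst w, G w)) -` (C \<times> E0) \<inter> space ?W" by blast
    also have "emeasure ?W \<dots> = emeasure R (C \<times> E0)"
      unfolding G_law[symmetric] by (rule emeasure_distr[symmetric]) measurable
    also have "\<dots> = emeasure P ((\<lambda>p. (fst p, f (snd p))) -` (C \<times> E0) \<inter> space P)"
      unfolding R_def by (rule emeasure_distr) measurable
    also have "(\<lambda>p. (fst p, f (snd p))) -` (C \<times> E0) \<inter> space P = {p\<in>space P. fst p \<in> C \<and> f (snd p) \<in> E0}" by blast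
    also have "emeasure P \<dots> = emeasure P X"
    proof (rule emeasure_eq_AE)
      show "AE p in P. p \<in> {p\<in>space P. fst p \<in> C \<and> f (snd p) \<in> E0} \<longleftrightarrow> p \<in> X"
        using P_E AE_space by eventually_elim (auto simp: X mem_Times_iff)
      show "X \<in> sets P" unfolding X by (simp add: sets_P)
    qed measurable
    finally show "emeasure (distr (completion ?W) (S \<Otimes>\<^sub>M M) (\<lambda>w. (fst w, h w))) X = emeasure P X" .
  next
    show "range (\<lambda>_. space S \<times> space M) \<subseteq> {C \<times> E | C E. C \<in> sets S \<and> E \<in> sets M}" by blast
  qed simp
  with h show thesis by (intro that[of h]) (simp_all add: \<nu>_def)
qed

section \<open>The joining\<close>

lemma range_eq_measurable:
  assumes Y[measurable]: "Y \<in> M \<rightarrow>\<^sub>M real_seqs"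
  shows "{w\<in>space (real_seqs \<Otimes>\<^sub>M M). range (fst w) = range (Y (snd w))} \<in> sets (real_seqs \<Otimes>\<^sub>M M)"
proof -
  have eq: "range a = range b \<longleftrightarrow> (\<forall>i. \<exists>j. a i = b j) \<and> (\<forall>j. \<exists>i. a i = b j)" for a b :: "nat \<Rightarrow> real"
    by (auto simp: set_eq_iff image_iff) metis+
  have "{w\<in>space (real_seqs \<Otimes>\<^sub>M M). fst w i = Y (snd w) j} \<in> sets (real_seqs \<Otimes>\<^sub>M M)" for i j
    by (rule borel_measurable_eq) measurable
  then show ?thesis
    unfolding eq
    by (intro sets.sets_Collect_conj sets.sets_Collect_countable_All sets.sets_Collect_countable_Ex)
qed

text \<open>
  Here \<open>Q\<close> extends \<open>M\<close>, and \<open>Z\<close> enumerates on \<open>Q\<close> the random set that \<open>Y\<close> enumerates on \<open>M\<close>. Starting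
  from the distribution of \<open>Z\<close> alone one can draw a point of \<open>M\<close> whose set has that enumeration.
\<close>

lemma realize_point_carrying_enumeration:
  fixes M :: "'a measure" and Q :: "'q measure"
  assumes M: "standard_prob_space M" and Q: "prob_space Q"
    and \<pi>[measurable]: "\<pi> \<in> Q \<rightarrow>\<^sub>M M" and \<pi>_distr: "distr Q M \<pi> = M"
    and Z[measurable]: "Z \<in> Q \<rightarrow>\<^sub>M real_seqs" and Y[measurable]: "Y \<in> M \<rightarrow>\<^sub>M real_seqs"
    and range: "\<And>q. q \<in> space Q \<Longrightarrow> range (Z q) = range (Y (\<pi> q))"
  obtains h where "h \<in> completion (distr Q real_seqs Z \<Otimes>\<^sub>M unif) \<rightarrow>\<^sub>M M"
    "distr (completion (distr Q real_seqs Z \<Otimes>\<^sub>M unif)) M h = M"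
    "AE w in completion (distr Q real_seqs Z \<Otimes>\<^sub>M unif). range (fst w) = range (Y (h w))"
proof -
  interpret Q: prob_space Q by fact
  define P where "P = distr Q (real_seqs \<Otimes>\<^sub>M M) (\<lambda>q. (Z q, \<pi> q))"
  have P: "prob_space P" unfolding P_def by (rule Q.prob_space_distr) measurable
  have fst_P: "distr P real_seqs fst = distr Q real_seqs Z"
    unfolding P_def by (subst distr_distr) (auto simp: comp_def)
  have snd_P: "distr P M snd = M"
    unfolding P_def by (subst distr_distr) (auto simp: comp_def \<pi>_distr)
  have sets_P: "sets P = sets (real_seqs \<Otimes>\<^sub>M M)" by (simp add: P_def)
  let ?W = "completion (distr Q real_seqs Z \<Otimes>\<^sub>M unif)"
  obtain h where h: "h \<in> ?W \<rightarrow>\<^sub>M M" and law: "distr ?W (real_seqs \<Otimes>\<^sub>M M) (\<lambda>w. (fst w, h w)) = P"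
    using conditional_realization[OF M P sets_P snd_P] unfolding fst_P by blast
  have "fst \<in> ?W \<rightarrow>\<^sub>M real_seqs"
    by (rule measurable_completion) (simp cong: measurable_cong_sets)
  then have pair: "(\<lambda>w. (fst w, h w)) \<in> ?W \<rightarrow>\<^sub>M real_seqs \<Otimes>\<^sub>M M"
    using h by (rule measurable_Pair)
  have "distr ?W M h = distr P M snd"
    unfolding law[symmetric] by (subst distr_distr[OF measurable_snd pair]) (simp add: comp_def)
  moreover have "AE p in P. range (fst p) = range (Y (snd p))"
    unfolding P_def
    by (subst AE_distr_iff) (use range range_eq_measurable[OF Y] in \<open>auto intro!: AE_I2\<close>)
  then have "AE w in ?W. range (fst (fst w, h w)) = range (Y (snd (fst w, h w)))"
    unfolding law[symmetric] by (rule AE_distrD[OF pair])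
  ultimately show thesis
    using h snd_P by (intro that[of h]) simp_all
qed

theorem theorem1p8:
  fixes M1 :: "'a measure" and M2 :: "'b measure"
    and X1 :: "'a \<Rightarrow> real set" and X2 :: "'b \<Rightarrow> real set"
  assumes "standard_prob_space M1" and "standard_prob_space M2"
    and "random_DCS M1 0 1 X1" and "random_DCS M2 0 1 X2"
    and "independence_condition M1 X1" and "independence_condition M2 X2"
    and "\<And>A. A \<in> sets borel \<Longrightarrow> A \<subseteq> {0<..<1} \<Longrightarrow> emeasure lborel A = 0 \<Longrightarrow>
           AE \<omega> in M1. X1 \<omega> \<inter> A = {}"
    and "\<And>A. A \<in> sets borel \<Longrightarrow> A \<subseteq> {0<..<1} \<Longrightarrow> emeasure lborel A > 0 \<Longrightarrow>
           AE \<omega> in M1. infinite (X1 \<omega> \<inter> A)"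
    and "\<And>A. A \<in> sets borel \<Longrightarrow> A \<subseteq> {0<..<1} \<Longrightarrow> emeasure lborel A = 0 \<Longrightarrow>
           AE \<omega> in M2. X2 \<omega> \<inter> A = {}"
    and "\<And>A. A \<in> sets borel \<Longrightarrow> A \<subseteq> {0<..<1} \<Longrightarrow> emeasure lborel A > 0 \<Longrightarrow>
           AE \<omega> in M2. infinite (X2 \<omega> \<inter> A)"
  shows "identically_distributed_DCS M1 X1 M2 X2"
proof -
  interpret M1: prob_space M1 using assms(1) by (simp add: standard_prob_space_def)
  interpret M2: prob_space M2 using assms(2) by (simp add: standard_prob_space_def)
  interpret Q1: pair_prob_space M1 noise ..
  interpret Q2: pair_prob_space M2 noise ..
  obtain Y1 where Y1: "measurable_enumeration M1 0 1 X1 Y1"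
    using assms(3) by (auto simp: random_DCS_def)
  obtain Y2 where Y2: "measurable_enumeration M2 0 1 X2 Y2"
    using assms(4) by (auto simp: random_DCS_def)
  have seq1: "Y1 \<in> M1 \<rightarrow>\<^sub>M real_seqs" and seq2: "Y2 \<in> M2 \<rightarrow>\<^sub>M real_seqs"
    using Y1 Y2 by (auto simp: measurable_enumeration_def intro: measurable_distinct_seqs_real_seqs)
  have inj1: "inj (Y1 \<omega>)" if "\<omega> \<in> space M1" for \<omega>
    using Y1 that by (auto simp: measurable_enumeration_def distinct_seqs_def measurable_restrict_space2_iff)
  have inj2: "inj (Y2 \<omega>)" if "\<omega> \<in> space M2" for \<omega>
    using Y2 that by (auto simp: measurable_enumeration_def distinct_seqs_def measurable_restrict_space2_iff)
  have dich1: "hit_dichotomy M1 Y1 n D" if "D \<in> sets (real_seqs \<Otimes>\<^sub>M borel)" for n D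
    by (rule hit_dichotomy_if_independent[OF M1.prob_space_axioms assms(5,7,8) Y1 that])
  have dich2: "hit_dichotomy M2 Y2 n D" if "D \<in> sets (real_seqs \<Otimes>\<^sub>M borel)" for n D
    by (rule hit_dichotomy_if_independent[OF M2.prob_space_axioms assms(6,9,10) Y2 that])
  obtain Z1 Z2 where Z1: "Z1 \<in> M1 \<Otimes>\<^sub>M noise \<rightarrow>\<^sub>M real_seqs" and Z2: "Z2 \<in> M2 \<Otimes>\<^sub>M noise \<rightarrow>\<^sub>M real_seqs"
    and Z_distr: "distr (M1 \<Otimes>\<^sub>M noise) real_seqs Z1 = distr (M2 \<Otimes>\<^sub>M noise) real_seqs Z2"
    and range1: "\<And>q. q \<in> space (M1 \<Otimes>\<^sub>M noise) \<Longrightarrow> range (Z1 q) = range (Y1 (fst q))"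
    and range2: "\<And>q. q \<in> space (M2 \<Otimes>\<^sub>M noise) \<Longrightarrow> range (Z2 q) = range (Y2 (fst q))"
    using common_random_enumeration[OF M1.prob_space_axioms seq1 inj1 dich1
        M2.prob_space_axioms seq2 inj2 dich2] by blast
  \<comment> \<open>Both points are drawn from the same sequence with the same extra noise; a joining may correlate them in any way.\<close>
  define W where "W = completion (distr (M1 \<Otimes>\<^sub>M noise) real_seqs Z1 \<Otimes>\<^sub>M unif)"
  obtain h1 where h1: "h1 \<in> W \<rightarrow>\<^sub>M M1" "distr W M1 h1 = M1" "AE w in W. range (fst w) = range (Y1 (h1 w))"
    unfolding W_def
    using realize_point_carrying_enumeration[OF assms(1) Q1.P.prob_space_axioms measurable_fst
        noise.distr_pair_fst Z1 seq1 range1] by blast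
  obtain h2 where h2: "h2 \<in> W \<rightarrow>\<^sub>M M2" "distr W M2 h2 = M2" "AE w in W. range (fst w) = range (Y2 (h2 w))"
    unfolding W_def Z_distr
    using realize_point_carrying_enumeration[OF assms(2) Q2.P.prob_space_axioms measurable_fst
        noise.distr_pair_fst Z2 seq2 range2] by blast
  interpret W: prob_space W
  proof -
    interpret L: prob_space "distr (M1 \<Otimes>\<^sub>M noise) real_seqs Z1" by (rule Q1.P.prob_space_distr[OF Z1])
    interpret LU: pair_prob_space "distr (M1 \<Otimes>\<^sub>M noise) real_seqs Z1" unif ..
    show "prob_space W" unfolding W_def by (rule LU.P.prob_space_completion)
  qed
  have "AE \<omega> in distr W M1 h1. X1 \<omega> = range (Y1 \<omega>)"
    unfolding h1(2) using Y1 by (simp add: measurable_enumeration_def)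
  then have X1: "AE w in W. X1 (h1 w) = range (Y1 (h1 w))" by (rule AE_distrD[OF h1(1)])
  have "AE \<omega> in distr W M2 h2. X2 \<omega> = range (Y2 \<omega>)"
    unfolding h2(2) using Y2 by (simp add: measurable_enumeration_def)
  then have X2: "AE w in W. X2 (h2 w) = range (Y2 (h2 w))" by (rule AE_distrD[OF h2(1)])
  have meas: "{\<omega>\<in>space (M1 \<Otimes>\<^sub>M M2). range (Y1 (fst \<omega>)) = range (Y2 (snd \<omega>))} \<in> sets (M1 \<Otimes>\<^sub>M M2)"
  proof -
    have "(\<lambda>\<omega>. (Y1 (fst \<omega>), snd \<omega>)) \<in> M1 \<Otimes>\<^sub>M M2 \<rightarrow>\<^sub>M real_seqs \<Otimes>\<^sub>M M2"
      using seq1 by measurable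
    from measurable_sets[OF this range_eq_measurable[OF seq2]]
    show ?thesis
      by (rule back_subst[where P="\<lambda>A. A \<in> sets (M1 \<Otimes>\<^sub>M M2)"])
         (use measurable_space[OF seq1] in \<open>auto simp: space_pair_measure\<close>)
  qed
  have pair: "(\<lambda>w. (h1 w, h2 w)) \<in> W \<rightarrow>\<^sub>M M1 \<Otimes>\<^sub>M M2"
    using h1(1) h2(1) by (rule measurable_Pair)
  define J where "J = distr W (M1 \<Otimes>\<^sub>M M2) (\<lambda>w. (h1 w, h2 w))"
  show ?thesis
    unfolding identically_distributed_DCS_def
  proof (intro exI[of _ J] conjI)
    show "prob_space J" unfolding J_def by (rule W.prob_space_distr[OF pair])
    show "sets J = sets (M1 \<Otimes>\<^sub>M M2)" by (simp add: J_def)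
    show J1: "distr J M1 fst = M1"
      unfolding J_def by (subst distr_distr[OF measurable_fst pair]) (simp add: comp_def h1)
    show J2: "distr J M2 snd = M2"
      unfolding J_def by (subst distr_distr[OF measurable_snd pair]) (simp add: comp_def h2)
    have "AE \<omega> in J. range (Y1 (fst \<omega>)) = range (Y2 (snd \<omega>))"
      unfolding J_def AE_distr_iff[OF pair meas] using h1(3) h2(3) by eventually_elim simp
    moreover have "AE \<omega> in J. X1 (fst \<omega>) = range (Y1 (fst \<omega>))"
    proof -
      have "AE \<omega> in distr J M1 fst. X1 \<omega> = range (Y1 \<omega>)"
        unfolding J1 using Y1 by (simp add: measurable_enumeration_def)
      then show ?thesis by (rule AE_distrD[rotated]) (simp add: J_def)
    qed
    moreover have "AE \<omega> in J. X2 (snd \<omega>) = range (Y2 (snd \<omega>))"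
    proof -
      have "AE \<omega> in distr J M2 snd. X2 \<omega> = range (Y2 \<omega>)"
        unfolding J2 using Y2 by (simp add: measurable_enumeration_def)
      then show ?thesis by (rule AE_distrD[rotated]) (simp add: J_def)
    qed
    ultimately show "AE \<omega> in J. X1 (fst \<omega>) = X2 (snd \<omega>)"
      by eventually_elim simp
  qed
qed

end
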